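(* Let $n\ge 5$. Then (a) $\lambda_2(\mathsf Q'_n) > \lambda_2(\mathsf Q'_{n-1})+1$; (b) $\lambda_2(\mathsf Q_n) > \lambda_2(\mathsf Q_{n-1})+\lambda_2(\mathsf Q'_n)$.
   Context: For a real symmetric matrix $M$, $\lambda_1(M)\ge\lambda_2(M)\ge\cdots$ denote its eigenvalues in non-increasing order. For $m\ge4$, $\mathsf Q_m$ is the symmetric $m\times m$ pentadiagonal matrix with $\mathsf Q_m[i,i+1]=\mathsf Q_m[i+1,i]=m-2$ ($1\le i\le m-1$), $\mathsf Q_m[i,i+2]=\mathsf Q_m[i+2,i]=2$ ($1\le i\le m-2$), all entries with $|i-j|\ge3$ equal to $0$, and diagonal entries $\mathsf Q_m[1,1]=\mathsf Q_m[m,m]=\frac{m^2-m-6}{2}$, $\mathsf Q_m[2,2]=\mathsf Q_m[m-1,m-1]=\frac{m^2-3m-2}{2}$, and $\mathsf Q_m[i,i]=\frac{m^2-3m-6}{2}$ for $3\le i\le m-2$. For $m\ge4$, $\mathsf Q'_m$ is the symmetric $m\times m$ matrix with $\mathsf Q'_m[1,2]=\mathsf Q'_m[2,1]=m-2$, $\mathsf Q'_m[1,3]=\mathsf Q'_m[3,1]=2$, $\mathsf Q'_m[2,3]=\mathsf Q'_m[3,2]=1$, $\mathsf Q'_m[i,i+1]=\mathsf Q'_m[i+1,i]=1$ for $3\le i\le m-1$, diagonal entries $\mathsf Q'_m[1,1]=0$, $\mathsf Q'_m[2,2]=1$, $\mathsf Q'_m[3,3]=m-4$, $\mathsf Q'_m[i,i]=m-2$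 for $4\le i\le m-1$, $\mathsf Q'_m[m,m]=m-1$, and all other entries $0$. (These are the adjacency matrices of the Schreier graphs $\operatorname{Sch}(S_m,[m],\mathcal R_m(2))$ and $\operatorname{Sch}(S_m,[m],\mathcal R'_m(2))$ respectively.) *)

theory Defs
  imports "Jordan_Normal_Form.Char_Poly"
begin

text \<open>
  \<open>eigval_desc k A\<close> is $\lambda_k(A)$, the \<open>k\<close>-th largest eigenvalue of \<open>A\<close> counted with
  multiplicity, the index \<open>k\<close> starting at 1.  The multiset \<open>proots (char_poly A)\<close> contains the
  real roots of the characteristic polynomial only; for a real symmetric matrix these are all
  of its roots, so that the list has as many entries as \<open>A\<close> has rows.  For \<open>k = 0\<close>, or \<open>k\<close> larger
  than the number of real roots, the value has no meaning.
\<close>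

definition eigvals_desc :: "real mat \<Rightarrow> real list" where
  "eigvals_desc A = rev (sorted_list_of_multiset (proots (char_poly A)))"

definition eigval_desc :: "nat \<Rightarrow> real mat \<Rightarrow> real" where
  "eigval_desc k A = eigvals_desc A ! (k - 1)"

text \<open>
  The entry functions below use row and column indices in \<open>{1..m}\<close>, whereas the indices of the
  type \<^typ>\<open>real mat\<close> start at 0.  They are meant for \<open>m \<ge> 4\<close> only: for smaller \<open>m\<close> the
  cases of the definitions overlap.
\<close>

definition Q_entry :: "nat \<Rightarrow> nat \<Rightarrow> nat \<Rightarrow> real" where
  "Q_entry m i j =
    (if i = j then
       (if i = 1 \<or> i = m then ((real m)\<^sup>2 - real m - 6) / 2
        else if i = 2 \<or> i = m - 1 then ((real m)\<^sup>2 - 3 * real m - 2) / 2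
        else ((real m)\<^sup>2 - 3 * real m - 6) / 2)
     else if j = i + 1 \<or> i = j + 1 then real m - 2
     else if j = i + 2 \<or> i = j + 2 then 2
     else 0)"

definition Q_mat :: "nat \<Rightarrow> real mat" where
  "Q_mat m = mat m m (\<lambda>(i, j). Q_entry m (i + 1) (j + 1))"

definition Q'_entry :: "nat \<Rightarrow> nat \<Rightarrow> nat \<Rightarrow> real" where
  "Q'_entry m i j =
    (if i = j then
       (if i = 1 then 0
        else if i = 2 then 1
        else if i = 3 then real m - 4
        else if i = m then real m - 1
        else real m - 2)
     else if {i, j} = {1, 2} then real m - 2
     else if {i, j} = {1, 3} then 2
     else if {i, j} = {2, 3} then 1
     else if (3 \<le> i \<and> j = i + 1) \<or> (3 \<le> j \<and> i = j + 1) then 1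
     else 0)"

definition Q'_mat :: "nat \<Rightarrow> real mat" where
  "Q'_mat m = mat m m (\<lambda>(i, j). Q'_entry m (i + 1) (j + 1))"

end

theory Submission
  imports Defs "Jordan_Normal_Form.Schur_Decomposition"
begin

text \<open>
  Both matrices have constant row sums $d$, so they are $d I - L$ for a weighted graph Laplacian $L$,
  and $d - \lambda_2$ is the second smallest eigenvalue of $L$.  Write $\mu_n$ and $\nu_n$ for these
  gaps of $\mathsf Q_n$ and $\mathsf Q'_n$.  Then (a) says $\nu_n < \nu_{n-1}$ and (b) says
  $\mu_n < \mu_{n-1} + \nu_n$, which follows from $\nu_n > 0$ and $\mu_n < \mu_{n-1}$.  Both gaps are
  compared by turning an eigenvector $f$ for $n-1$ into a test vector for $n$.

  For $\mathsf Q'$, duplicate the vertex $p \ge 3$ of the path with $|f_p|$ maximal.  Only the larger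
  weight of the edge $\{1,2\}$ increases the energy, by $(f_1 - f_2)^2$, and the eigenvalue equations
  at the vertices 1 and 2 together with $\sum f = 0$ bound this by a small multiple of $\nu f_p^2$.

  For $\mathsf Q$ and $n \ge 7$, interpolate $f$ by $F_j = ((j-1) f_{j-1} + (n-j) f_j)/(n-1)$ and
  estimate the energy of $F$ by convexity, in terms of $P = \sum (f_k - f_{k+1})^2$ and
  $D = \sum (f_k - f_{k+2})^2$.  This suffices once $D \ge \frac{16}{7} P$, which the eigenvalue equation
  provides.  The cases $n = 5, 6$ follow from explicit bounds for $\mu_4, \mu_5, \mu_6$.
\<close>

section \<open>The second eigenvalue of a real symmetric matrix\<close>

lemma conjugate_real_vec: "conjugate v = (v :: real vec)"
  by (rule eq_vecI) auto

text \<open>\<open>corthogonal\<close> also says that no \<open>ws ! i\<close> is orthogonal to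
  itself, so all lengths are positive and can be divided by.\<close>

lemma real_corthogonal_normalise:
  fixes ws :: "real vec list"
  assumes ws: "set ws \<subseteq> carrier_vec n" "corthogonal ws" "length ws = n"
  defines "W \<equiv> mat_of_cols n (map (\<lambda>w. (1 / sqrt (w \<bullet> w)) \<cdot>\<^sub>v w) ws)"
  shows "W\<^sup>T * W = 1\<^sub>m n"
proof (rule eq_matI)
  show "dim_row (W\<^sup>T * W) = dim_row (1\<^sub>m n)" "dim_col (W\<^sup>T * W) = dim_col (1\<^sub>m n)"
    using ws(3) by (auto simp: W_def)
  fix i j assume "i < dim_row (1\<^sub>m n :: real mat)" "j < dim_col (1\<^sub>m n :: real mat)"
  then have i: "i < n" and j: "j < n" by auto
  have c: "ws ! i \<in> carrier_vec n" "ws ! j \<in> carrier_vec n" using ws i j by auto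
  have o: "(ws ! i \<bullet> ws ! j = 0) = (i \<noteq> j)"
    using ws(2,3) i j unfolding corthogonal_def conjugate_real_vec by auto
  have nn: "ws ! i \<bullet> ws ! i \<ge> 0" unfolding scalar_prod_def by (auto intro: sum_nonneg)
  have "(W\<^sup>T * W) $$ (i, j) = (1 / sqrt (ws ! i \<bullet> ws ! i)) * (1 / sqrt (ws ! j \<bullet> ws ! j)) * (ws ! i \<bullet> ws ! j)"
    using i j c ws(3) by (simp add: W_def)
  also have "\<dots> = 1\<^sub>m n $$ (i, j)"
  proof (cases "i = j")
    case True
    have "ws ! i \<bullet> ws ! i > 0"
      using nn ws(2,3) i unfolding corthogonal_def conjugate_real_vec by (metis less_eq_real_def)
    then show ?thesis using True i by (simp add: field_simps flip: real_sqrt_mult)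
  next
    case False
    then show ?thesis using o i j by simp
  qed
  finally show "(W\<^sup>T * W) $$ (i, j) = 1\<^sub>m n $$ (i, j)" .
qed

text \<open>Complete \<open>v\<close> to a basis, apply Gram-Schmidt, which keeps the first vector,
  and normalise. Only the direction of column 0 matters later, so \<open>c\<close> stays
  unspecified.\<close>

lemma orthogonal_completion:
  fixes v :: "real vec"
  assumes v: "v \<in> carrier_vec n" "v \<noteq> 0\<^sub>v n"
  obtains W c where "W \<in> carrier_mat n n" "W\<^sup>T * W = 1\<^sub>m n" "W * W\<^sup>T = 1\<^sub>m n"
    "col W 0 = c \<cdot>\<^sub>v v"
proof -
  interpret cof_vec_space n "TYPE(real)" .
  define ws where "ws = gram_schmidt n (basis_completion v)"
  define W where "W = mat_of_cols n (map (\<lambda>w. (1 / sqrt (w \<bullet> w)) \<cdot>\<^sub>v w) ws)"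
  note b = basis_completion[OF v]
  have n: "n \<noteq> 0" using v by (metis carrier_vecD eq_vecI less_nat_zero_code zero_carrier_vec)
  obtain vs where bv: "basis_completion v = v # vs"
    using b(6,7) n by (cases "basis_completion v") auto
  have ws: "set ws \<subseteq> carrier_vec n" "corthogonal ws" "length ws = n"
    using gram_schmidt_result[OF b(2,4,5), of ws] b(6) by (auto simp: ws_def)
  have hd: "hd ws = v" using gram_schmidt_hd[OF v(1), of vs] by (simp add: ws_def bv)
  have W: "W \<in> carrier_mat n n" using ws(3) by (auto simp: W_def mat_of_cols_def)
  have 1: "W\<^sup>T * W = 1\<^sub>m n" unfolding W_def by (rule real_corthogonal_normalise[OF ws])
  have 2: "W * W\<^sup>T = 1\<^sub>m n"
    using mat_mult_left_right_inverse[OF _ W 1] W by simp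
  have "ws ! 0 = v" using hd n ws(3) by (metis hd_conv_nth length_0_conv)
  then have "col W 0 = (1 / sqrt (v \<bullet> v)) \<cdot>\<^sub>v v"
    using n ws(3) v(1) by (simp add: W_def)
  then show ?thesis using that W 1 2 by blast
qed

text \<open>One step of the spectral theorem. In an orthonormal basis starting with the direction of
  \<open>v\<close> the first column is \<open>e\<close> times a unit vector, and symmetry clears the
  first row as well. \<open>B\<close> is the compression of \<open>A\<close> to the complement of
  \<open>v\<close>.\<close>

lemma symmetric_deflation:
  fixes A :: "real mat"
  assumes A: "A \<in> carrier_mat (Suc n) (Suc n)" "A\<^sup>T = A"
    and v: "eigenvector A v e"
  obtains W B c where "W \<in> carrier_mat (Suc n) (Suc n)" "W\<^sup>T * W = 1\<^sub>m (Suc n)" "W * W\<^sup>T = 1\<^sub>m (Suc n)"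
    "col W 0 = c \<cdot>\<^sub>v v" "B \<in> carrier_mat n n" "B\<^sup>T = B"
    "W\<^sup>T * A * W = four_block_mat (mat 1 1 (\<lambda>_. e)) (0\<^sub>m 1 n) (0\<^sub>m n 1) B"
    "char_poly A = [:-e, 1:] * char_poly B"
proof -
  have v': "v \<in> carrier_vec (Suc n)" "v \<noteq> 0\<^sub>v (Suc n)" and ev: "A *\<^sub>v v = e \<cdot>\<^sub>v v"
    using v A(1) by (auto simp: eigenvector_def)
  obtain W c where W: "W \<in> carrier_mat (Suc n) (Suc n)" "W\<^sup>T * W = 1\<^sub>m (Suc n)" "W * W\<^sup>T = 1\<^sub>m (Suc n)"
    and c: "col W 0 = c \<cdot>\<^sub>v v"
    using orthogonal_completion[OF v'] by blast
  define A' where "A' = W\<^sup>T * A * W"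
  define B where "B = mat n n (\<lambda>(i, j). A' $$ (Suc i, Suc j))"
  have A': "A' \<in> carrier_mat (Suc n) (Suc n)" using W A by (auto simp: A'_def)
  have sym: "A'\<^sup>T = A'"
    unfolding A'_def using W(1) A
    by (simp add: transpose_mult[of _ "Suc n" "Suc n" _ "Suc n"] assoc_mult_mat[of _ "Suc n" "Suc n" _ "Suc n" _ "Suc n"])
  have symE: "A' $$ (i, j) = A' $$ (j, i)" if "i < Suc n" "j < Suc n" for i j
    using arg_cong[OF sym, of "\<lambda>M. M $$ (j, i)"] that A' by auto
  have ev': "A *\<^sub>v col W 0 = e \<cdot>\<^sub>v col W 0"
    using A(1) v'(1) ev unfolding c by (simp add: mult_mat_vec smult_smult_assoc mult.commute)
  have col0: "A' $$ (i, 0) = (if i = 0 then e else 0)" if i: "i < Suc n" for i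
  proof -
    have "A' = W\<^sup>T * (A * W)" unfolding A'_def using W(1) A(1) by simp
    then have "A' $$ (i, 0) = col W i \<bullet> (A *\<^sub>v col W 0)"
      using W(1) A(1) i by (simp add: mult_mat_vec_def)
    also have "\<dots> = e * (col W i \<bullet> col W 0)" unfolding ev' using W(1) i by simp
    also have "col W i \<bullet> col W 0 = (W\<^sup>T * W) $$ (i, 0)" using W(1) i by simp
    also have "\<dots> = (if i = 0 then 1 else 0)" unfolding W(2) using i by simp
    finally show ?thesis by simp
  qed
  have blk: "A' = four_block_mat (mat 1 1 (\<lambda>_. e)) (0\<^sub>m 1 n) (0\<^sub>m n 1) B"
    using A' col0 symE[of 0] by (intro eq_matI) (auto simp: B_def)
  have B: "B \<in> carrier_mat n n" "B\<^sup>T = B" using symE by (auto simp: B_def intro!: eq_matI)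
  have "similar_mat_wit A' A (W\<^sup>T) W"
    using W A A' by (intro similar_mat_witI[of _ _ "Suc n"]) (auto simp: A'_def)
  then have "similar_mat A' A" unfolding similar_mat_def by blast
  then have "char_poly A = char_poly A'" using char_poly_similar by metis
  also have "\<dots> = char_poly (mat 1 1 (\<lambda>_. e)) * char_poly B"
    unfolding blk by (rule char_poly_four_block_zeros_col) (auto simp: B_def)
  also have "char_poly (mat 1 1 (\<lambda>_. e)) = [:-e, 1:]"
    by (simp add: char_poly_defs det_def sign_def)
  finally show ?thesis using that W c B blk unfolding A'_def by blast
qed

text \<open>The coordinates of \<open>x\<close> in the new basis are those of
  \<open>W\<^sup>T *\<^sub>v x\<close>; \<open>y\<close> collects all but the first. On vectors
  orthogonal to the eigenvector the form is therefore that of \<open>B\<close> alone.\<close>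

lemma symmetric_quadratic_deflation:
  fixes A :: "real mat"
  assumes W: "W \<in> carrier_mat (Suc n) (Suc n)" "W * W\<^sup>T = 1\<^sub>m (Suc n)"
    and A: "A \<in> carrier_mat (Suc n) (Suc n)" and B: "B \<in> carrier_mat n n"
    and blk: "W\<^sup>T * A * W = four_block_mat (mat 1 1 (\<lambda>_. e)) (0\<^sub>m 1 n) (0\<^sub>m n 1) B"
    and x: "x \<in> carrier_vec (Suc n)"
  obtains y where "y \<in> carrier_vec n"
    "x \<bullet> x = (col W 0 \<bullet> x)\<^sup>2 + y \<bullet> y"
    "x \<bullet> (A *\<^sub>v x) = e * (col W 0 \<bullet> x)\<^sup>2 + y \<bullet> (B *\<^sub>v y)"
proof -
  define z where "z = W\<^sup>T *\<^sub>v x"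
  define y where "y = vec_last z n"
  have z: "z \<in> carrier_vec (1 + n)" using W(1) x unfolding z_def by (metis mult_mat_vec_carrier plus_1_eq_Suc transpose_carrier_mat)
  have y: "y \<in> carrier_vec n" by (simp add: y_def)
  have z0: "z $ 0 = col W 0 \<bullet> x" using W by (simp add: z_def)
  define a where "a = vec 1 (\<lambda>_. z $ 0)"
  have a: "a \<in> carrier_vec 1" by (simp add: a_def)
  have aa: "a \<bullet> a = (z $ 0)\<^sup>2" by (simp add: a_def scalar_prod_def power2_eq_square)
  have split: "z = a @\<^sub>v y"
    using vec_first_last_append[OF z] by (simp add: a_def y_def vec_first_def) (smt (verit) One_nat_def eq_vecI dim_vec index_vec less_one)
  have Wz: "W *\<^sub>v z = x"
    unfolding z_def using W x by (subst assoc_mult_mat_vec[symmetric]) auto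
  have "z \<bullet> z = (W\<^sup>T *\<^sub>v x) \<bullet> z" by (simp add: z_def)
  also have "\<dots> = x \<bullet> (W *\<^sub>v z)" using W z x by (intro transpose_vec_mult_scalar) auto
  finally have zz: "z \<bullet> z = x \<bullet> x" using Wz by simp
  have "z \<bullet> ((W\<^sup>T * A * W) *\<^sub>v z) = z \<bullet> (W\<^sup>T *\<^sub>v (A *\<^sub>v x))"
    using W A z Wz x by (simp add: assoc_mult_mat_vec[of _ "Suc n" "Suc n" _ "Suc n"])
  also have "\<dots> = (W\<^sup>T *\<^sub>v (A *\<^sub>v x)) \<bullet> z" using W A x z by (intro comm_scalar_prod) auto
  also have "\<dots> = (A *\<^sub>v x) \<bullet> (W *\<^sub>v z)" using W A x z by (intro transpose_vec_mult_scalar) auto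
  also have "\<dots> = x \<bullet> (A *\<^sub>v x)" unfolding Wz using A x by (intro comm_scalar_prod) auto
  finally have q: "x \<bullet> (A *\<^sub>v x) = z \<bullet> ((W\<^sup>T * A * W) *\<^sub>v z)" by simp
  have ea: "mat 1 1 (\<lambda>_. e) *\<^sub>v a = e \<cdot>\<^sub>v a" by (rule eq_vecI) (auto simp: a_def scalar_prod_def)
  have "(W\<^sup>T * A * W) *\<^sub>v z = (e \<cdot>\<^sub>v a) @\<^sub>v (B *\<^sub>v y)"
    unfolding blk split using mult_mat_vec_split[OF _ B a y, of "mat 1 1 (\<lambda>_. e)"] ea by simp
  then have "x \<bullet> (A *\<^sub>v x) = (a @\<^sub>v y) \<bullet> ((e \<cdot>\<^sub>v a) @\<^sub>v (B *\<^sub>v y))" using q split by simp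
  also have "\<dots> = a \<bullet> (e \<cdot>\<^sub>v a) + y \<bullet> (B *\<^sub>v y)"
    using a y B by (intro scalar_prod_append) auto
  also have "a \<bullet> (e \<cdot>\<^sub>v a) = e * (z $ 0)\<^sup>2" using a aa by simp
  finally have 2: "x \<bullet> (A *\<^sub>v x) = e * (z $ 0)\<^sup>2 + y \<bullet> (B *\<^sub>v y)" .
  have "x \<bullet> x = (z $ 0)\<^sup>2 + y \<bullet> y"
    unfolding zz[symmetric] split using scalar_prod_append[OF a y a y] aa split by simp
  then show ?thesis using that y 2 unfolding z0 by blast
qed

section \<open>Real eigenvalues and the Rayleigh bound\<close>

text \<open>Over the complex numbers there is an eigenvalue \<open>k\<close>. The Hermitian form at
  its eigenvector, \<open>?s\<close>, equals its own conjugate by symmetry and is \<open>k\<close>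
  times the positive number \<open>?N\<close>, so \<open>k\<close> is real.\<close>

lemma symmetric_real_eigenvalue:
  fixes A :: "real mat"
  assumes A: "A \<in> carrier_mat n n" "A\<^sup>T = A" and n: "n \<noteq> 0"
  obtains e where "eigenvalue A e"
proof -
  let ?C = "map_mat complex_of_real A"
  have C: "?C \<in> carrier_mat n n" using A by simp
  obtain as where as: "char_poly ?C = (\<Prod> a \<leftarrow> as. [:- a, 1:])" "length as = n"
    using char_poly_factorized[OF C] by blast
  then obtain k where "k \<in> set as" using n by (cases as) auto
  then have "poly (char_poly ?C) k = 0" unfolding as poly_prod_list by (auto simp: prod_list_zero_iff)
  then have "eigenvalue ?C k" using eigenvalue_root_char_poly[OF C] by simp
  then obtain v where v: "v \<in> carrier_vec n" "v \<noteq> 0\<^sub>v n" "?C *\<^sub>v v = k \<cdot>\<^sub>v v"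
    using C unfolding eigenvalue_def eigenvector_def by auto
  have row: "(\<Sum>j<n. of_real (A $$ (i, j)) * v $ j) = k * v $ i" if "i < n" for i
    using arg_cong[OF v(3), of "\<lambda>u. u $ i"] that A(1) v(1)
    by (simp add: scalar_prod_def atLeast0LessThan)
  have sym: "A $$ (i, j) = A $$ (j, i)" if "i < n" "j < n" for i j
    using arg_cong[OF A(2), of "\<lambda>M. M $$ (j, i)"] that A(1) by auto
  let ?s = "\<Sum>i<n. \<Sum>j<n. cnj (v $ i) * of_real (A $$ (i, j)) * v $ j"
  let ?N = "\<Sum>i<n. (cmod (v $ i))\<^sup>2"
  have "?s = (\<Sum>i<n. cnj (v $ i) * (k * v $ i))"
    by (intro sum.cong refl) (simp add: row[symmetric] sum_distrib_left mult.assoc)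
  also have "\<dots> = k * of_real ?N"
    by (simp add: sum_distrib_left complex_norm_square mult_ac flip: of_real_power)
  finally have s: "?s = k * of_real ?N" .
  have "cnj ?s = (\<Sum>i<n. \<Sum>j<n. cnj (v $ j) * of_real (A $$ (i, j)) * v $ i)"
    by (simp add: mult_ac)
  also have "\<dots> = (\<Sum>j<n. \<Sum>i<n. cnj (v $ j) * of_real (A $$ (i, j)) * v $ i)"
    by (rule sum.swap)
  also have "\<dots> = ?s" by (intro sum.cong refl) (simp add: sym)
  finally have "cnj k * of_real ?N = k * of_real ?N" unfolding s by simp
  moreover have "?N \<noteq> 0"
  proof
    assume "?N = 0"
    then have "\<forall>i<n. v $ i = 0" by (subst (asm) sum_nonneg_eq_0_iff) auto
    then show False using v(1,2) by (metis carrier_vecD eq_vecI index_zero_vec)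
  qed
  ultimately have "cnj k = k" by (metis mult_right_cancel of_real_eq_0_iff)
  then have k: "k = complex_of_real (Re k)" by (metis Reals_cnj_iff of_real_Re)
  have "poly (char_poly ?C) (of_real (Re k)) = 0" using \<open>poly (char_poly ?C) k = 0\<close> k by simp
  then have "poly (char_poly A) (Re k) = 0" unfolding of_real_hom.char_poly_hom[OF A(1)] by simp
  then show ?thesis using that eigenvalue_root_char_poly[OF A(1)] by blast
qed

text \<open>Induction on the dimension: deflation splits off one eigenvector, and the factorisation
  of \<open>char_poly A\<close> hands the eigenvalue bound down to \<open>B\<close>.\<close>

lemma rayleigh_le:
  fixes A :: "real mat"
  assumes "A \<in> carrier_mat n n" "A\<^sup>T = A" "\<And>e. eigenvalue A e \<Longrightarrow> e \<le> l" "x \<in> carrier_vec n"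
  shows "x \<bullet> (A *\<^sub>v x) \<le> l * (x \<bullet> x)"
  using assms
proof (induction n arbitrary: A x)
  case 0
  then show ?case by (simp add: scalar_prod_def)
next
  case (Suc n)
  obtain e where e: "eigenvalue A e" using symmetric_real_eigenvalue[OF Suc.prems(1,2)] by auto
  then obtain v where v: "eigenvector A v e" unfolding eigenvalue_def by blast
  obtain W B c where W: "W \<in> carrier_mat (Suc n) (Suc n)" "W * W\<^sup>T = 1\<^sub>m (Suc n)"
    and B: "B \<in> carrier_mat n n" "B\<^sup>T = B"
    and blk: "W\<^sup>T * A * W = four_block_mat (mat 1 1 (\<lambda>_. e)) (0\<^sub>m 1 n) (0\<^sub>m n 1) B"
    and cp: "char_poly A = [:-e, 1:] * char_poly B"
    using symmetric_deflation[OF Suc.prems(1,2) v] by metis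
  obtain y where y: "y \<in> carrier_vec n" "x \<bullet> x = (col W 0 \<bullet> x)\<^sup>2 + y \<bullet> y"
    "x \<bullet> (A *\<^sub>v x) = e * (col W 0 \<bullet> x)\<^sup>2 + y \<bullet> (B *\<^sub>v y)"
    using symmetric_quadratic_deflation[OF W Suc.prems(1) B(1) blk Suc.prems(4)] by metis
  have "e' \<le> l" if "eigenvalue B e'" for e'
    using that Suc.prems(3) cp
    unfolding eigenvalue_root_char_poly[OF Suc.prems(1)] eigenvalue_root_char_poly[OF B(1)] by simp
  then have "y \<bullet> (B *\<^sub>v y) \<le> l * (y \<bullet> y)" using Suc.IH B y(1) by blast
  moreover have "e * (col W 0 \<bullet> x)\<^sup>2 \<le> l * (col W 0 \<bullet> x)\<^sup>2"
    using Suc.prems(3)[OF e] by (simp add: mult_right_mono)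
  ultimately show ?case unfolding y(2,3) by (simp add: distrib_left)
qed

section \<open>The second largest eigenvalue\<close>

text \<open>The roots for \<open>A\<close> are those for \<open>B\<close> and one more copy of
  \<open>d\<close>, which heads the descending list by \<open>le\<close>. The second entry is thus
  the largest root for \<open>B\<close>, even if \<open>d\<close> is a multiple root;
  \<open>ex\<close> ensures that it exists.\<close>

lemma eigval_desc_2_deflation:
  fixes A B :: "real mat"
  assumes cp: "char_poly A = [:-d, 1:] * char_poly B" and ne: "char_poly B \<noteq> 0"
    and le: "\<And>e. poly (char_poly A) e = 0 \<Longrightarrow> e \<le> d"
    and ex: "poly (char_poly B) e = 0"
  shows "poly (char_poly B) (eigval_desc 2 A) = 0"
    and "e \<le> eigval_desc 2 A"
proof -
  let ?s = "sorted_list_of_multiset (proots (char_poly B))"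
  have P: "proots (char_poly A) = add_mset d (proots (char_poly B))"
    unfolding cp using ne by (subst proots_mult) auto
  have set: "set ?s = {x. poly (char_poly B) x = 0}" using ne by simp
  have led: "x \<le> d" if "x \<in> set ?s" for x using that le unfolding set cp by simp
  have sorted: "sorted ?s" by simp
  have "eigvals_desc A = rev (insort d ?s)"
    unfolding eigvals_desc_def P by simp
  also have "insort d ?s = ?s @ [d]"
    using led by (intro sorted_insort_is_snoc) auto
  finally have *: "eigvals_desc A = d # rev ?s" by simp
  have nemp: "?s \<noteq> []" using set ex by (metis empty_set emptyE mem_Collect_eq)
  have l: "eigval_desc 2 A = last ?s"
    using nemp unfolding eigval_desc_def * by (simp add: hd_conv_nth[symmetric] hd_rev)
  show "poly (char_poly B) (eigval_desc 2 A) = 0"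
    using last_in_set[OF nemp] unfolding set l by simp
  have "e \<in> set ?s" unfolding set using ex by simp
  then obtain i where "i < length ?s" "e = ?s ! i" by (metis in_set_conv_nth)
  then show "e \<le> eigval_desc 2 A"
    unfolding l last_conv_nth[OF nemp] using sorted_nth_mono[OF sorted] by simp
qed

text \<open>Courant-Fischer for the second eigenvalue. By \<open>le\<close>, \<open>d\<close> is the
  top eigenvalue, so the second one is the top eigenvalue of the compression \<open>B\<close> to the
  complement of \<open>u\<close>, to which \<open>rayleigh_le\<close> applies.\<close>

lemma second_eigenvalue:
  fixes A :: "real mat"
  assumes A: "A \<in> carrier_mat n n" "A\<^sup>T = A" and n: "n \<ge> 2"
    and u: "eigenvector A u d"
    and le: "\<And>x. x \<in> carrier_vec n \<Longrightarrow> x \<bullet> (A *\<^sub>v x) \<le> d * (x \<bullet> x)"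
  shows "\<exists>f. eigenvector A f (eigval_desc 2 A) \<and> u \<bullet> f = 0"
    and "\<And>x. x \<in> carrier_vec n \<Longrightarrow> u \<bullet> x = 0 \<Longrightarrow> x \<bullet> (A *\<^sub>v x) \<le> eigval_desc 2 A * (x \<bullet> x)"
proof -
  obtain m where m: "n = Suc m" "m \<noteq> 0" using n by (cases n) auto
  have u': "u \<in> carrier_vec (Suc m)" "u \<noteq> 0\<^sub>v (Suc m)" using u A(1) m(1) by (auto simp: eigenvector_def)
  note A = A[unfolded m(1)]
  obtain W B c where W: "W \<in> carrier_mat (Suc m) (Suc m)" "W\<^sup>T * W = 1\<^sub>m (Suc m)" "W * W\<^sup>T = 1\<^sub>m (Suc m)"
    and c: "col W 0 = c \<cdot>\<^sub>v u" and B: "B \<in> carrier_mat m m" "B\<^sup>T = B"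
    and blk: "W\<^sup>T * A * W = four_block_mat (mat 1 1 (\<lambda>_. d)) (0\<^sub>m 1 m) (0\<^sub>m m 1) B"
    and cp: "char_poly A = [:-d, 1:] * char_poly B"
    using symmetric_deflation[OF A u] by metis
  have "c \<noteq> 0"
  proof
    assume "c = 0"
    then have "col W 0 \<bullet> col W 0 = 0" unfolding c using u'(1) by simp
    moreover have "col W 0 \<bullet> col W 0 = (W\<^sup>T * W) $$ (0, 0)" using W(1) by simp
    ultimately show False unfolding W(2) by simp
  qed
  let ?l = "eigval_desc 2 A"
  have eigle: "e \<le> d" if "poly (char_poly A) e = 0" for e
  proof -
    have "eigenvalue A e" using that eigenvalue_root_char_poly[OF A(1)] by simp
    then obtain v where "eigenvector A v e" unfolding eigenvalue_def by blast
    then have v: "v \<in> carrier_vec n" "v \<noteq> 0\<^sub>v n" "A *\<^sub>v v = e \<cdot>\<^sub>v v"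
      using A(1) m(1) by (auto simp: eigenvector_def)
    have "0 < v \<bullet> v"
      using conjugate_square_greater_0_vec[OF v(1)] v(2) by (simp add: conjugate_real_vec)
    then show ?thesis using le[OF v(1)] v by simp
  qed
  have ne: "char_poly B \<noteq> 0" using degree_monic_char_poly[OF B(1)] by auto
  obtain e0 where "eigenvalue B e0" using symmetric_real_eigenvalue[OF B m(2)] by auto
  note d2 = eigval_desc_2_deflation[OF cp ne eigle]
  have "eigenvalue B ?l"
    using d2(1) \<open>eigenvalue B e0\<close> unfolding eigenvalue_root_char_poly[OF B(1)] by blast
  then obtain w where w: "w \<in> carrier_vec m" "w \<noteq> 0\<^sub>v m" "B *\<^sub>v w = ?l \<cdot>\<^sub>v w"
    using B(1) unfolding eigenvalue_def eigenvector_def by auto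
  \<comment> \<open>The leading coordinate 0 makes the lifted vector \<open>f\<close> orthogonal to
    \<open>u\<close>.\<close>
  define z where "z = 0\<^sub>v 1 @\<^sub>v w"
  have z: "z \<in> carrier_vec (Suc m)" using append_carrier_vec[OF zero_carrier_vec w(1), of 1] by (simp add: z_def)
  define f where "f = W *\<^sub>v z"
  have f: "f \<in> carrier_vec (Suc m)" using W(1) z unfolding f_def by (rule mult_mat_vec_carrier)
  have Wf: "W\<^sup>T *\<^sub>v f = z" unfolding f_def using W z by (subst assoc_mult_mat_vec[symmetric]) auto
  have z0: "z \<noteq> 0\<^sub>v (Suc m)"
  proof
    assume z': "z = 0\<^sub>v (Suc m)"
    have "w $ i = 0" if "i < m" for i
    proof -
      have "w $ i = z $ Suc i" using that w(1) by (simp add: z_def)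
      then show ?thesis using that z' by simp
    qed
    then show False using w(1,2) by auto
  qed
  have "(W\<^sup>T * A * W) *\<^sub>v z = ?l \<cdot>\<^sub>v z"
  proof -
    have 1: "mat 1 1 (\<lambda>_. d) *\<^sub>v 0\<^sub>v 1 = 0\<^sub>v 1" by (rule eq_vecI) (auto simp: scalar_prod_def)
    have "(W\<^sup>T * A * W) *\<^sub>v z = 0\<^sub>v 1 @\<^sub>v (?l \<cdot>\<^sub>v w)"
      unfolding blk z_def by (subst mult_mat_vec_split[OF _ B(1) _ w(1)]) (auto simp: 1 w(3))
    also have "\<dots> = ?l \<cdot>\<^sub>v z" unfolding z_def using w(1) by (intro eq_vecI) auto
    finally show ?thesis .
  qed
  moreover have "(W\<^sup>T * A * W) *\<^sub>v z = W\<^sup>T *\<^sub>v (A *\<^sub>v f)"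
    using W A z by (simp add: f_def assoc_mult_mat_vec[of _ "Suc m" "Suc m" _ "Suc m"])
  ultimately have "W *\<^sub>v (W\<^sup>T *\<^sub>v (A *\<^sub>v f)) = W *\<^sub>v (?l \<cdot>\<^sub>v z)" by simp
  moreover have "W *\<^sub>v (W\<^sup>T *\<^sub>v (A *\<^sub>v f)) = A *\<^sub>v f"
    using W A f by (subst assoc_mult_mat_vec[symmetric]) auto
  moreover have "W *\<^sub>v (?l \<cdot>\<^sub>v z) = ?l \<cdot>\<^sub>v f"
    using W z by (simp add: f_def mult_mat_vec)
  ultimately have "A *\<^sub>v f = ?l \<cdot>\<^sub>v f" by simp
  moreover have "f \<noteq> 0\<^sub>v (Suc m)" using Wf z0 W by auto
  ultimately have "eigenvector A f ?l" using A(1) f by (auto simp: eigenvector_def)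
  moreover have "u \<bullet> f = 0"
  proof -
    have "c * (u \<bullet> f) = col W 0 \<bullet> f" unfolding c using u'(1) f by simp
    also have "\<dots> = (W\<^sup>T *\<^sub>v f) $ 0" using W(1) by simp
    also have "\<dots> = 0" unfolding Wf by (simp add: z_def)
    finally show ?thesis using \<open>c \<noteq> 0\<close> by simp
  qed
  ultimately show "\<exists>f. eigenvector A f ?l \<and> u \<bullet> f = 0" by blast
  fix x :: "real vec" assume x: "x \<in> carrier_vec n" and ux: "u \<bullet> x = 0"
  have "col W 0 \<bullet> x = 0" unfolding c using ux x u'(1) m(1) by simp
  then obtain y where y: "y \<in> carrier_vec m" "x \<bullet> x = y \<bullet> y" "x \<bullet> (A *\<^sub>v x) = y \<bullet> (B *\<^sub>v y)"
    using symmetric_quadratic_deflation[OF W(1,3) A(1) B(1) blk x[unfolded m(1)]] by auto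
  show "x \<bullet> (A *\<^sub>v x) \<le> ?l * (x \<bullet> x)"
    unfolding y(2,3)
    using d2(2) y(1) by (intro rayleigh_le[OF B]) (auto simp: eigenvalue_root_char_poly[OF B(1)])
qed

lemma of_bool_mult_if:
  fixes z :: real
  shows "of_bool P * z = (if P then z else 0)" "z * of_bool P = (if P then z else 0)"
  by auto

text \<open>The matrix is \<open>d\<close> times the identity minus a Laplacian with form
  \<open>E\<close>. By \<open>const\<close> and \<open>nonneg\<close> the all-ones vector belongs to
  the largest eigenvalue \<open>d\<close>. The eigenvalue equation is stated weakly, against every
  \<open>y\<close>, because later proofs pick such test functions.\<close>

lemma second_eigenvalue_form:
  fixes a :: "nat \<Rightarrow> nat \<Rightarrow> real" and E :: "(nat \<Rightarrow> real) \<Rightarrow> (nat \<Rightarrow> real) \<Rightarrow> real"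
  assumes n: "n \<ge> 2"
    and form: "\<And>x y. (\<Sum>i<n. \<Sum>j<n. y i * a i j * x j) = d * (\<Sum>i<n. y i * x i) - E y x"
    and sym: "\<And>x y. E x y = E y x"
    and const: "\<And>y. E y (\<lambda>_. 1) = 0" and nonneg: "\<And>x. E x x \<ge> 0"
  defines "\<mu> \<equiv> d - eigval_desc 2 (mat n n (\<lambda>(i, j). a i j))"
  shows "\<exists>f. (\<Sum>i<n. f i) = 0 \<and> (\<Sum>i<n. (f i)\<^sup>2) > 0 \<and> (\<forall>y. E y f = \<mu> * (\<Sum>i<n. y i * f i))"
    and "\<And>x. (\<Sum>i<n. x i) = 0 \<Longrightarrow> \<mu> * (\<Sum>i<n. (x i)\<^sup>2) \<le> E x x"
proof -
  define A where "A = mat n n (\<lambda>(i, j). a i j)"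
  let ?l = "eigval_desc 2 A" and ?u = "vec n (\<lambda>_. 1 :: real)"
  have A: "A \<in> carrier_mat n n" by (simp add: A_def)
  \<comment> \<open>Testing with unit vectors recovers the entries and transfers the symmetry of
    \<open>E\<close> to the matrix.\<close>
  have a: "a i j = (if i = j then d else 0) - E (\<lambda>k. of_bool (k = i)) (\<lambda>k. of_bool (k = j))"
    if "i < n" "j < n" for i j
    using form[of "\<lambda>k. of_bool (k = i)" "\<lambda>k. of_bool (k = j)"] that
    by (simp add: of_bool_mult_if)
  have symA: "A\<^sup>T = A" using a sym by (intro eq_matI) (auto simp: A_def)
  have mv: "A *\<^sub>v vec n X = vec n (\<lambda>i. \<Sum>j<n. a i j * X j)" for X
    by (intro eq_vecI) (auto simp: A_def scalar_prod_def atLeast0LessThan)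
  have sp: "vec n X \<bullet> vec n Y = (\<Sum>i<n. X i * Y i)" for X Y :: "nat \<Rightarrow> real"
    by (simp add: scalar_prod_def atLeast0LessThan)
  have q: "vec n Y \<bullet> (A *\<^sub>v vec n X) = d * (\<Sum>i<n. Y i * X i) - E Y X" for X Y
    unfolding mv sp form[symmetric] by (simp add: sum_distrib_left mult.assoc)
  have ex: "x = vec n (($) x)" if "x \<in> carrier_vec n" for x :: "real vec"
    using that by (intro eq_vecI) simp_all
  have "(\<Sum>j<n. a i j) = d" if "i < n" for i
  proof -
    have "(\<Sum>k<n. \<Sum>j<n. of_bool (k = i) * a k j * 1) = (\<Sum>k<n. if k = i then \<Sum>j<n. a k j else 0)"
      by (intro sum.cong refl) simp
    then show ?thesis
      using form[of "\<lambda>k. of_bool (k = i)" "\<lambda>_. 1"] that const by (simp add: of_bool_mult_if)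
  qed
  then have "A *\<^sub>v ?u = d \<cdot>\<^sub>v ?u" unfolding mv by (intro eq_vecI) auto
  moreover have "?u \<noteq> 0\<^sub>v n"
  proof
    assume "?u = 0\<^sub>v n"
    then have "?u $ 0 = 0\<^sub>v n $ 0" by simp
    then show False using n by simp
  qed
  ultimately have u: "eigenvector A ?u d" using A by (simp add: eigenvector_def)
  have le: "x \<bullet> (A *\<^sub>v x) \<le> d * (x \<bullet> x)" if "x \<in> carrier_vec n" for x
  proof -
    have "vec n X \<bullet> (A *\<^sub>v vec n X) \<le> d * (vec n X \<bullet> vec n X)" for X
      unfolding q sp using nonneg[of X] by simp
    then show ?thesis using ex[OF that] by metis
  qed
  note S = second_eigenvalue[OF A symA n u le]
  obtain g where g: "eigenvector A g ?l" "?u \<bullet> g = 0" using S(1) by blast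
  then have gc: "g \<in> carrier_vec n" "g \<noteq> 0\<^sub>v n" "A *\<^sub>v g = ?l \<cdot>\<^sub>v g" using A by (auto simp: eigenvector_def)
  define f where "f = ($) g"
  have gf: "g = vec n f" unfolding f_def by (rule ex[OF gc(1)])
  have "(\<Sum>i<n. f i) = 0" using g(2) unfolding gf sp by simp
  moreover have "(\<Sum>i<n. (f i)\<^sup>2) > 0"
    using conjugate_square_greater_0_vec[OF gc(1)] gc(2)
    unfolding conjugate_real_vec gf sp by (simp add: power2_eq_square)
  moreover have "E y f = \<mu> * (\<Sum>i<n. y i * f i)" for y
  proof -
    have "vec n y \<bullet> (A *\<^sub>v g) = vec n y \<bullet> (?l \<cdot>\<^sub>v g)" using gc(3) by simp
    also have "\<dots> = ?l * (\<Sum>i<n. y i * f i)" unfolding gf using sp[of y f] by simp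
    finally show ?thesis
      unfolding gf q by (simp add: \<mu>_def A_def algebra_simps)
  qed
  ultimately show "\<exists>f. (\<Sum>i<n. f i) = 0 \<and> (\<Sum>i<n. (f i)\<^sup>2) > 0 \<and> (\<forall>y. E y f = \<mu> * (\<Sum>i<n. y i * f i))"
    by blast
  fix x :: "nat \<Rightarrow> real" assume "(\<Sum>i<n. x i) = 0"
  then have "vec n x \<bullet> (A *\<^sub>v vec n x) \<le> ?l * (vec n x \<bullet> vec n x)"
    by (intro S(2)) (auto simp: sp)
  then show "\<mu> * (\<Sum>i<n. (x i)\<^sup>2) \<le> E x x"
    unfolding q sp by (simp add: \<mu>_def A_def power2_eq_square algebra_simps)
qed

section \<open>Laplacian forms\<close>

text \<open>Each edge contributes a rank-one matrix built from the difference of the unit vectors at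
  its endpoints; pairing this difference with a function gives the increment along the edge.\<close>

lemma sum_edge_form:
  fixes x y :: "nat \<Rightarrow> real"
  assumes "finite S" "\<And>k. k \<in> S \<Longrightarrow> s k < n" "\<And>k. k \<in> S \<Longrightarrow> t k < n"
  shows "(\<Sum>i<n. \<Sum>j<n. y i * (\<Sum>k\<in>S. w k * (of_bool (i = s k) - of_bool (i = t k))
      * (of_bool (j = s k) - of_bool (j = t k))) * x j)
    = (\<Sum>k\<in>S. w k * (y (s k) - y (t k)) * (x (s k) - x (t k)))"
proof -
  have d: "(\<Sum>i<n. (of_bool (i = s k) - of_bool (i = t k)) * z i) = z (s k) - z (t k)"
    if "k \<in> S" for k and z :: "nat \<Rightarrow> real"
    using assms(2,3)[OF that]
    by (simp add: left_diff_distrib sum_subtractf of_bool_mult_if)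
  have "(\<Sum>i<n. \<Sum>j<n. y i * (\<Sum>k\<in>S. w k * (of_bool (i = s k) - of_bool (i = t k))
      * (of_bool (j = s k) - of_bool (j = t k))) * x j)
    = (\<Sum>i<n. \<Sum>j<n. \<Sum>k\<in>S. w k * ((of_bool (i = s k) - of_bool (i = t k)) * y i)
      * ((of_bool (j = s k) - of_bool (j = t k)) * x j))"
    by (simp add: sum_distrib_left sum_distrib_right mult_ac)
  also have "\<dots> = (\<Sum>i<n. \<Sum>k\<in>S. \<Sum>j<n. w k * ((of_bool (i = s k) - of_bool (i = t k)) * y i)
      * ((of_bool (j = s k) - of_bool (j = t k)) * x j))"
    by (intro sum.cong refl sum.swap)
  also have "\<dots> = (\<Sum>k\<in>S. \<Sum>i<n. \<Sum>j<n. w k * ((of_bool (i = s k) - of_bool (i = t k)) * y i)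
      * ((of_bool (j = s k) - of_bool (j = t k)) * x j))"
    by (rule sum.swap)
  also have "\<dots> = (\<Sum>k\<in>S. w k * (\<Sum>i<n. (of_bool (i = s k) - of_bool (i = t k)) * y i)
      * (\<Sum>j<n. (of_bool (j = s k) - of_bool (j = t k)) * x j))"
    by (intro sum.cong refl) (simp add: sum_distrib_left sum_distrib_right mult_ac)
  also have "\<dots> = (\<Sum>k\<in>S. w k * (y (s k) - y (t k)) * (x (s k) - x (t k)))"
    by (intro sum.cong refl) (simp add: d)
  finally show ?thesis .
qed

text \<open>On the diagonal the two terms count the edges leaving \<open>i\<close> upwards and
  downwards; the other two terms are the adjacency of vertices at distance \<open>p\<close>.\<close>

lemma shift_edge_entry:
  fixes i j n p q :: nat
  assumes "i < n" "j < n" "0 < p"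
  shows "(\<Sum>k\<in>{q..<n - p}. (of_bool (i = k) - of_bool (i = k + p)) * (of_bool (j = k) - of_bool (j = k + p)))
    = (of_bool (i = j \<and> q \<le> i \<and> i < n - p) + of_bool (i = j \<and> q + p \<le> i)
       - of_bool (j = i + p \<and> q \<le> i) - of_bool (i = j + p \<and> q \<le> j) :: real)"
proof -
  have 1: "(of_bool (i = k) - of_bool (i = k + p)) * (of_bool (j = k) - of_bool (j = k + p))
     = (if k = i then of_bool (i = j) else 0) + (if k = i - p then of_bool (i = j \<and> p \<le> i) else 0)
      - (if k = i then of_bool (j = i + p) else 0) - (if k = j then of_bool (i = j + p) else 0 :: real)" for k
  proof -
    have "of_bool (i = k) * of_bool (j = k) = (if k = i then of_bool (i = j) else 0 :: real)"
      "of_bool (i = k) * of_bool (j = k + p) = (if k = i then of_bool (j = i + p) else 0 :: real)"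
      "of_bool (i = k + p) * of_bool (j = k) = (if k = j then of_bool (i = j + p) else 0 :: real)"
      by simp_all
    \<comment> \<open>The guard \<open>p \<le> i\<close> excludes the truncated case of
      \<open>i - p\<close>.\<close>
    moreover have "i = k + p \<longleftrightarrow> k = i - p \<and> p \<le> i" by linarith
    then have "of_bool (i = k + p) * of_bool (j = k + p) = (if k = i - p then of_bool (i = j \<and> p \<le> i) else 0 :: real)"
      by (cases "i = j") auto
    ultimately show ?thesis by (simp only: left_diff_distrib right_diff_distrib)
  qed
  have 2: "i - p \<in> {q..<n - p} \<and> i = j \<and> p \<le> i \<longleftrightarrow> i = j \<and> q + p \<le> i"
    "i \<in> {q..<n - p} \<and> j = i + p \<longleftrightarrow> j = i + p \<and> q \<le> i"
    "j \<in> {q..<n - p} \<and> i = j + p \<longleftrightarrow> i = j + p \<and> q \<le> j"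
    "i \<in> {q..<n - p} \<and> i = j \<longleftrightarrow> i = j \<and> q \<le> i \<and> i < n - p"
    using assms by auto
  have 3: "(if P then of_bool Q else 0 :: real) = of_bool (P \<and> Q)" for P Q by simp
  show ?thesis
    unfolding 1 sum.distrib sum_subtractf by (simp only: sum.delta finite_atLeastLessThan) (simp only: 3 2)
qed

lemma shift_edge_form:
  fixes x y :: "nat \<Rightarrow> real"
  assumes "p \<le> n"
  shows "(\<Sum>i<n. \<Sum>j<n. y i * (\<Sum>k\<in>{q..<n - p}. (of_bool (i = k) - of_bool (i = k + p))
      * (of_bool (j = k) - of_bool (j = k + p))) * x j)
    = (\<Sum>k\<in>{q..<n - p}. (y k - y (k + p)) * (x k - x (k + p)))"
proof -
  have "k < n" "k + p < n" if "k \<in> {q..<n - p}" for k using that by auto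
  then show ?thesis
    using sum_edge_form[of "{q..<n - p}" "\<lambda>k. k" n "\<lambda>k. k + p" y "\<lambda>_. 1" x] by simp
qed

lemma single_edge_form:
  fixes x y :: "nat \<Rightarrow> real"
  assumes "u < n" "v < n"
  shows "(\<Sum>i<n. \<Sum>j<n. y i * ((of_bool (i = u) - of_bool (i = v)) * (of_bool (j = u) - of_bool (j = v))) * x j)
    = (y u - y v) * (x u - x v)"
  using sum_edge_form[of "{0::nat}" "\<lambda>_. u" n "\<lambda>_. v" y "\<lambda>_. 1" x] assms by simp

section \<open>Laplacian forms of the two matrices\<close>

text \<open>The Laplacian behind \<open>Q_mat n\<close>, kept bilinear so that an eigenvector can be
  tested against other functions. Vertices are counted from 0.\<close>

definition Q_form :: "nat \<Rightarrow> (nat \<Rightarrow> real) \<Rightarrow> (nat \<Rightarrow> real) \<Rightarrow> real" where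
  "Q_form n y x = (real n - 2) * (\<Sum>k<n - 1. (y k - y (k + 1)) * (x k - x (k + 1)))
     + 2 * (\<Sum>k<n - 2. (y k - y (k + 2)) * (x k - x (k + 2)))"

text \<open>The underlying graph is a weighted triangle on 0, 1, 2 with a path of unit weights
  attached at vertex 2.\<close>

definition Q'_form :: "nat \<Rightarrow> (nat \<Rightarrow> real) \<Rightarrow> (nat \<Rightarrow> real) \<Rightarrow> real" where
  "Q'_form n y x = (real n - 2) * ((y 0 - y 1) * (x 0 - x 1)) + 2 * ((y 0 - y 2) * (x 0 - x 2))
     + (y 1 - y 2) * (x 1 - x 2) + (\<Sum>k\<in>{2..<n - 1}. (y k - y (k + 1)) * (x k - x (k + 1)))"

text \<open>The coefficient of \<open>of_bool (i = j)\<close> is the common row sum. The diagonal is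
  this number minus the weighted degree: n at the ends, 2n - 2 next to them, 2n elsewhere.\<close>

lemma Q_entry_decomp:
  assumes "n \<ge> 4" "i < n" "j < n"
  shows "Q_entry n (i + 1) (j + 1) = ((real n)\<^sup>2 + real n - 6) / 2 * of_bool (i = j)
    - (real n - 2) * (\<Sum>k\<in>{0..<n - 1}. (of_bool (i = k) - of_bool (i = k + 1)) * (of_bool (j = k) - of_bool (j = k + 1)))
    - 2 * (\<Sum>k\<in>{0..<n - 2}. (of_bool (i = k) - of_bool (i = k + 2)) * (of_bool (j = k) - of_bool (j = k + 2)))"
proof -
  have *: "(\<Sum>k\<in>{0..<n - 1}. (of_bool (i = k) - of_bool (i = k + 1)) * (of_bool (j = k) - of_bool (j = k + 1)))
    = (of_bool (i = j \<and> i < n - 1) + of_bool (i = j \<and> 1 \<le> i) - of_bool (j = i + 1) - of_bool (i = j + 1) :: real)"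
    "(\<Sum>k\<in>{0..<n - 2}. (of_bool (i = k) - of_bool (i = k + 2)) * (of_bool (j = k) - of_bool (j = k + 2)))
    = (of_bool (i = j \<and> i < n - 2) + of_bool (i = j \<and> 2 \<le> i) - of_bool (j = i + 2) - of_bool (i = j + 2) :: real)"
    using assms by (subst shift_edge_entry; simp add: numeral_2_eq_2)+
  show ?thesis
  proof (cases "i = j")
    case True
    consider "i = 0" | "i = 1" | "2 \<le> i" "i < n - 2" | "i = n - 2" "2 \<le> i" | "i = n - 1" "2 \<le> i"
      using assms by linarith
    then show ?thesis
      unfolding * Q_entry_def using True assms by cases (auto simp: field_simps)
  next
    case False
    then show ?thesis unfolding * Q_entry_def by (auto simp: of_bool_def)
  qed
qed

text \<open>Every row sum is n. The weighted degrees are n, n - 1 and 4 on the triangle, then 2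
  along the path and 1 at its end.\<close>

lemma Q'_entry_decomp:
  assumes "n \<ge> 4" "i < n" "j < n"
  shows "Q'_entry n (i + 1) (j + 1) = real n * of_bool (i = j)
    - (real n - 2) * ((of_bool (i = 0) - of_bool (i = 1)) * (of_bool (j = 0) - of_bool (j = 1)))
    - 2 * ((of_bool (i = 0) - of_bool (i = 2)) * (of_bool (j = 0) - of_bool (j = 2)))
    - (of_bool (i = 1) - of_bool (i = 2)) * (of_bool (j = 1) - of_bool (j = 2))
    - (\<Sum>k\<in>{2..<n - 1}. (of_bool (i = k) - of_bool (i = k + 1)) * (of_bool (j = k) - of_bool (j = k + 1)))"
proof -
  have *: "(\<Sum>k\<in>{2..<n - 1}. (of_bool (i = k) - of_bool (i = k + 1)) * (of_bool (j = k) - of_bool (j = k + 1)))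
    = (of_bool (i = j \<and> 2 \<le> i \<and> i < n - 1) + of_bool (i = j \<and> 3 \<le> i)
       - of_bool (j = i + 1 \<and> 2 \<le> i) - of_bool (i = j + 1 \<and> 2 \<le> j) :: real)"
    using assms shift_edge_entry[of i n j 1 2] by simp
  consider "i = 0" | "i = 1" | "i = 2" | "3 \<le> i" by linarith
  then show ?thesis
  proof cases
    case 4
    consider "j = 0" | "j = 1" | "j = 2" | "3 \<le> j" by linarith
    then show ?thesis unfolding * Q'_entry_def using assms 4
      by cases (auto simp: of_bool_def doubleton_eq_iff)
  next
    case 1
    then show ?thesis unfolding * Q'_entry_def using assms
      by (auto simp: of_bool_def doubleton_eq_iff)
  next
    case 2
    then show ?thesis unfolding * Q'_entry_def using assms
      by (auto simp: of_bool_def doubleton_eq_iff)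
  next
    case 3
    then show ?thesis unfolding * Q'_entry_def using assms
      by (auto simp: of_bool_def doubleton_eq_iff)
  qed
qed

lemma sum_of_bool_form:
  fixes x y :: "nat \<Rightarrow> real"
  shows "(\<Sum>i<n. \<Sum>j<n. y i * of_bool (i = j) * x j) = (\<Sum>i<n. y i * x i)"
proof (intro sum.cong refl)
  fix i assume "i \<in> {..<n}"
  moreover have "(\<Sum>j<n. y i * of_bool (i = j) * x j) = (\<Sum>j<n. if j = i then y i * x j else 0)"
    by (intro sum.cong refl) auto
  ultimately show "(\<Sum>j<n. y i * of_bool (i = j) * x j) = y i * x i" by simp
qed

lemma Q_mat_form:
  assumes "n \<ge> 4"
  shows "(\<Sum>i<n. \<Sum>j<n. y i * Q_entry n (i + 1) (j + 1) * x j)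
    = ((real n)\<^sup>2 + real n - 6) / 2 * (\<Sum>i<n. y i * x i) - Q_form n y x"
proof -
  define a where "a i j = (\<Sum>k\<in>{0..<n - 1}. (of_bool (i = k) - of_bool (i = k + 1)) * (of_bool (j = k) - of_bool (j = k + 1)) :: real)" for i j
  define b where "b i j = (\<Sum>k\<in>{0..<n - 2}. (of_bool (i = k) - of_bool (i = k + 2)) * (of_bool (j = k) - of_bool (j = k + 2)) :: real)" for i j
  define d where "d = ((real n)\<^sup>2 + real n - 6) / 2"
  have "(\<Sum>i<n. \<Sum>j<n. y i * Q_entry n (i + 1) (j + 1) * x j)
    = (\<Sum>i<n. \<Sum>j<n. d * (y i * of_bool (i = j) * x j) - (real n - 2) * (y i * a i j * x j) - 2 * (y i * b i j * x j))"
  proof (intro sum.cong refl)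
    fix i j assume "i \<in> {..<n}" "j \<in> {..<n}"
    then have eq: "Q_entry n (i + 1) (j + 1) = d * of_bool (i = j) - (real n - 2) * a i j - 2 * b i j"
      using Q_entry_decomp[OF assms, of i j] unfolding a_def b_def d_def by simp
    show "y i * Q_entry n (i + 1) (j + 1) * x j
      = d * (y i * of_bool (i = j) * x j) - (real n - 2) * (y i * a i j * x j) - 2 * (y i * b i j * x j)"
      unfolding eq by (simp only: algebra_simps)
  qed
  also have "\<dots> = d * (\<Sum>i<n. y i * x i) - (real n - 2) * (\<Sum>i<n. \<Sum>j<n. y i * a i j * x j)
     - 2 * (\<Sum>i<n. \<Sum>j<n. y i * b i j * x j)"
    unfolding sum_subtractf sum_distrib_left[symmetric] sum_of_bool_form ..
  also have "(\<Sum>i<n. \<Sum>j<n. y i * a i j * x j) = (\<Sum>k\<in>{0..<n - 1}. (y k - y (k + 1)) * (x k - x (k + 1)))"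
    unfolding a_def using assms by (intro shift_edge_form) simp
  also have "(\<Sum>i<n. \<Sum>j<n. y i * b i j * x j) = (\<Sum>k\<in>{0..<n - 2}. (y k - y (k + 2)) * (x k - x (k + 2)))"
    unfolding b_def using assms by (intro shift_edge_form) simp
  finally show ?thesis by (simp add: Q_form_def d_def atLeast0LessThan)
qed

lemma Q'_mat_form:
  assumes "n \<ge> 4"
  shows "(\<Sum>i<n. \<Sum>j<n. y i * Q'_entry n (i + 1) (j + 1) * x j)
    = real n * (\<Sum>i<n. y i * x i) - Q'_form n y x"
proof -
  define e where "e u v i j = (of_bool (i = u) - of_bool (i = v)) * (of_bool (j = u) - of_bool (j = v) :: real)"
    for u v i j :: nat
  define b where "b i j = (\<Sum>k\<in>{2..<n - 1}. (of_bool (i = k) - of_bool (i = k + 1)) * (of_bool (j = k) - of_bool (j = k + 1)) :: real)" for i j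
  have "(\<Sum>i<n. \<Sum>j<n. y i * Q'_entry n (i + 1) (j + 1) * x j)
    = (\<Sum>i<n. \<Sum>j<n. real n * (y i * of_bool (i = j) * x j) - (real n - 2) * (y i * e 0 1 i j * x j)
         - 2 * (y i * e 0 2 i j * x j) - y i * e 1 2 i j * x j - y i * b i j * x j)"
  proof (intro sum.cong refl)
    fix i j assume "i \<in> {..<n}" "j \<in> {..<n}"
    then have eq: "Q'_entry n (i + 1) (j + 1) = real n * of_bool (i = j) - (real n - 2) * e 0 1 i j - 2 * e 0 2 i j
        - e 1 2 i j - b i j"
      using Q'_entry_decomp[OF assms, of i j] unfolding e_def b_def by simp
    show "y i * Q'_entry n (i + 1) (j + 1) * x j
      = real n * (y i * of_bool (i = j) * x j) - (real n - 2) * (y i * e 0 1 i j * x j)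
         - 2 * (y i * e 0 2 i j * x j) - y i * e 1 2 i j * x j - y i * b i j * x j"
      unfolding eq by (simp only: algebra_simps)
  qed
  also have "\<dots> = real n * (\<Sum>i<n. y i * x i) - (real n - 2) * (\<Sum>i<n. \<Sum>j<n. y i * e 0 1 i j * x j)
     - 2 * (\<Sum>i<n. \<Sum>j<n. y i * e 0 2 i j * x j) - (\<Sum>i<n. \<Sum>j<n. y i * e 1 2 i j * x j)
     - (\<Sum>i<n. \<Sum>j<n. y i * b i j * x j)"
    unfolding sum_subtractf sum_distrib_left[symmetric] sum_of_bool_form ..
  also have "(\<Sum>i<n. \<Sum>j<n. y i * b i j * x j) = (\<Sum>k\<in>{2..<n - 1}. (y k - y (k + 1)) * (x k - x (k + 1)))"
    unfolding b_def using assms by (intro shift_edge_form) simp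
  finally show ?thesis
    unfolding e_def using assms by (simp add: single_edge_form Q'_form_def)
qed

text \<open>By \<open>Q_mat_form\<close> and \<open>Q'_mat_form\<close> the matrices are a multiple of the identity minus a weighted
  graph Laplacian; the gaps are the second smallest Laplacian eigenvalues.\<close>

definition Q_gap :: "nat \<Rightarrow> real" where
  "Q_gap n = ((real n)\<^sup>2 + real n - 6) / 2 - eigval_desc 2 (Q_mat n)"

definition Q'_gap :: "nat \<Rightarrow> real" where
  "Q'_gap n = real n - eigval_desc 2 (Q'_mat n)"

lemma Q_gap:
  assumes "n \<ge> 4"
  shows Q_gap_eigenvector: "\<exists>f. (\<Sum>i<n. f i) = 0 \<and> (\<Sum>i<n. (f i)\<^sup>2) > 0 \<and>
      (\<forall>y. Q_form n y f = Q_gap n * (\<Sum>i<n. y i * f i))"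
    and Q_gap_le: "\<And>x. (\<Sum>i<n. x i) = 0 \<Longrightarrow> Q_gap n * (\<Sum>i<n. (x i)\<^sup>2) \<le> Q_form n x x"
proof -
  have 1: "n \<ge> 2" using assms by simp
  have 2: "Q_form n x y = Q_form n y x" for x y by (simp add: Q_form_def mult.commute)
  have 3: "Q_form n y (\<lambda>_. 1) = 0" for y by (simp add: Q_form_def)
  have 4: "Q_form n x x \<ge> 0" for x
    using assms unfolding Q_form_def by (intro add_nonneg_nonneg zero_le_square mult_nonneg_nonneg[OF _ zero_le_square]
        mult_nonneg_nonneg[OF _ sum_nonneg] sum_nonneg) auto
  note * = second_eigenvalue_form[OF 1 Q_mat_form[OF assms] 2 3 4]
  show "\<exists>f. (\<Sum>i<n. f i) = 0 \<and> (\<Sum>i<n. (f i)\<^sup>2) > 0 \<and>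
      (\<forall>y. Q_form n y f = Q_gap n * (\<Sum>i<n. y i * f i))"
    unfolding Q_gap_def Q_mat_def by (rule *(1))
  show "Q_gap n * (\<Sum>i<n. (x i)\<^sup>2) \<le> Q_form n x x" if "(\<Sum>i<n. x i) = 0" for x
    unfolding Q_gap_def Q_mat_def by (rule *(2)[OF that])
qed

lemma Q'_gap:
  assumes "n \<ge> 4"
  shows Q'_gap_eigenvector: "\<exists>f. (\<Sum>i<n. f i) = 0 \<and> (\<Sum>i<n. (f i)\<^sup>2) > 0 \<and>
      (\<forall>y. Q'_form n y f = Q'_gap n * (\<Sum>i<n. y i * f i))"
    and Q'_gap_le: "\<And>x. (\<Sum>i<n. x i) = 0 \<Longrightarrow> Q'_gap n * (\<Sum>i<n. (x i)\<^sup>2) \<le> Q'_form n x x"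
proof -
  have 1: "n \<ge> 2" using assms by simp
  have 2: "Q'_form n x y = Q'_form n y x" for x y by (simp add: Q'_form_def mult.commute)
  have 3: "Q'_form n y (\<lambda>_. 1) = 0" for y by (simp add: Q'_form_def)
  have 4: "Q'_form n x x \<ge> 0" for x
    using assms unfolding Q'_form_def by (intro add_nonneg_nonneg zero_le_square mult_nonneg_nonneg[OF _ zero_le_square]
        mult_nonneg_nonneg[OF _ sum_nonneg] sum_nonneg) auto
  note * = second_eigenvalue_form[OF 1 Q'_mat_form[OF assms] 2 3 4]
  show "\<exists>f. (\<Sum>i<n. f i) = 0 \<and> (\<Sum>i<n. (f i)\<^sup>2) > 0 \<and>
      (\<forall>y. Q'_form n y f = Q'_gap n * (\<Sum>i<n. y i * f i))"
    unfolding Q'_gap_def Q'_mat_def by (rule *(1))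
  show "Q'_gap n * (\<Sum>i<n. (x i)\<^sup>2) \<le> Q'_form n x x" if "(\<Sum>i<n. x i) = 0" for x
    unfolding Q'_gap_def Q'_mat_def by (rule *(2)[OF that])
qed

section \<open>Comparing the gaps of $\mathsf Q'_n$\<close>

lemma zero_if_constant_and_sum_zero:
  fixes f :: "nat \<Rightarrow> real"
  assumes "\<And>k. k < m \<Longrightarrow> f k = f (k + 1)" "(\<Sum>i<m + 1. f i) = 0" "i \<le> m"
  shows "f i = 0"
proof -
  have c: "f k = f 0" if "k \<le> m" for k
    using that
  proof (induction k)
    case (Suc k)
    then show ?case using assms(1)[of k] by simp
  qed simp
  have "(\<Sum>i<m + 1. f i) = (\<Sum>i<m + 1. f 0)" by (intro sum.cong refl c) auto
  then show ?thesis using assms(2) c[OF assms(3)] by simp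
qed

text \<open>The graph is connected: with a gap of at most 0 an eigenvector has no energy, so it is
  constant, and it vanishes because its sum is 0.\<close>

lemma Q'_gap_pos:
  assumes "n \<ge> 4"
  shows "Q'_gap n > 0"
proof (rule ccontr)
  assume neg: "\<not> Q'_gap n > 0"
  obtain f where f: "(\<Sum>i<n. f i) = 0" "(\<Sum>i<n. (f i)\<^sup>2) > 0"
    and ev: "\<And>y. Q'_form n y f = Q'_gap n * (\<Sum>i<n. y i * f i)"
    using Q'_gap_eigenvector[OF assms] by blast
  let ?P = "\<Sum>k\<in>{2..<n - 1}. (f k - f (k + 1))\<^sup>2"
  have "(real n - 2) * (f 0 - f 1)\<^sup>2 + 2 * (f 0 - f 2)\<^sup>2 + (f 1 - f 2)\<^sup>2 + ?P = Q'_gap n * (\<Sum>i<n. (f i)\<^sup>2)"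
    using ev[of f] by (simp add: Q'_form_def power2_eq_square)
  moreover have "Q'_gap n * (\<Sum>i<n. (f i)\<^sup>2) \<le> 0"
    using neg f(2) by (simp add: mult_nonpos_nonneg)
  moreover have "?P \<ge> 0" by (intro sum_nonneg) auto
  moreover have "(real n - 2) * (f 0 - f 1)\<^sup>2 \<ge> 0" using assms by simp
  moreover have "2 * (f 0 - f 2)\<^sup>2 \<ge> 0" "(f 1 - f 2)\<^sup>2 \<ge> 0" by simp_all
  ultimately have z: "(f 0 - f 2)\<^sup>2 = 0" "(f 1 - f 2)\<^sup>2 = 0" "?P = 0" by linarith+
  have "f k = f (k + 1)" if "k < n - 1" for k
  proof -
    have "(f k - f (k + 1))\<^sup>2 = 0" if "k \<in> {2..<n - 1}" for k
      using z(3) that by (subst (asm) sum_nonneg_eq_0_iff) auto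
    moreover have "k = 0 \<or> k = 1 \<or> k \<in> {2..<n - 1}" using that by auto
    \<comment> \<open>Vertices 0 and 1 are linked through vertex 2.\<close>
    ultimately show ?thesis using z(1,2) by (auto simp: numeral_2_eq_2)
  qed
  then have "f i = 0" if "i < n" for i
    using zero_if_constant_and_sum_zero[of "n - 1" f i] f(1) assms that by simp
  then show False using f(2) by simp
qed

section \<open>Duplicating a vertex of the path\<close>

definition duplicate :: "nat \<Rightarrow> (nat \<Rightarrow> 'a) \<Rightarrow> nat \<Rightarrow> 'a" where
  "duplicate p f j = (if j \<le> p then f j else f (j - 1))"

lemma sum_duplicate:
  fixes h :: "'a \<Rightarrow> real"
  assumes "p < n"
  shows "(\<Sum>j<n + 1. h (duplicate p f j)) = (\<Sum>j<n. h (f j)) + h (f p)"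
proof -
  have "Suc p \<le> n" using assms by simp
  then show ?thesis
  proof (induction rule: dec_induct)
    case base
    have "(\<Sum>j<Suc p. h (duplicate p f j)) = (\<Sum>j<Suc p. h (f j))"
      by (intro sum.cong) (auto simp: duplicate_def)
    then show ?case by (simp add: duplicate_def)
  next
    case (step m)
    then show ?case by (simp add: duplicate_def)
  qed
qed

text \<open>The two copies of \<open>f p\<close> are neighbours, so the additional edge carries
  difference 0.\<close>

lemma sum_duplicate_diff:
  fixes f :: "nat \<Rightarrow> real"
  assumes "q \<le> p" "p \<le> m"
  shows "(\<Sum>k\<in>{q..<m + 1}. (duplicate p f k - duplicate p f (k + 1))\<^sup>2) = (\<Sum>k\<in>{q..<m}. (f k - f (k + 1))\<^sup>2)"
  using assms(2)
proof (induction rule: dec_induct)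
  case base
  have "(\<Sum>k\<in>{q..<p}. (duplicate p f k - duplicate p f (k + 1))\<^sup>2) = (\<Sum>k\<in>{q..<p}. (f k - f (k + 1))\<^sup>2)"
    by (intro sum.cong) (auto simp: duplicate_def)
  then show ?case using assms(1) by (simp add: duplicate_def)
next
  case (step m)
  then show ?case using assms(1) by (simp add: duplicate_def)
qed

text \<open>As \<open>p\<close> is at least 2, the triangle keeps its values; only the weight of its
  edge from 0 to 1 grows, from n - 2 to n - 1.\<close>

lemma Q'_form_duplicate:
  assumes "2 \<le> p" "p < n"
  shows "Q'_form (n + 1) (duplicate p f) (duplicate p f) = Q'_form n f f + (f 0 - f 1)\<^sup>2"
proof -
  have 1: "n - 1 + 1 = n" "n + 1 - 1 = n" "real (n + 1) - 2 = real n - 2 + 1" using assms by simp_all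
  have 2: "duplicate p f 0 = f 0" "duplicate p f 1 = f 1" "duplicate p f 2 = f 2"
    using assms by (auto simp: duplicate_def)
  have 3: "(\<Sum>k\<in>{2..<n}. (duplicate p f k - duplicate p f (k + 1))\<^sup>2) = (\<Sum>k\<in>{2..<n - 1}. (f k - f (k + 1))\<^sup>2)"
    using sum_duplicate_diff[of 2 p "n - 1" f] assms unfolding 1 by linarith
  show ?thesis
    unfolding Q'_form_def power2_eq_square[symmetric] 1 2 3 distrib_right by simp
qed

text \<open>The test vector is \<open>duplicate p f\<close> minus its mean. Its squared norm exceeds
  that of \<open>f\<close> by at least 4/5 of the square of \<open>f p\<close>, while the energy
  grows by at most 2/9 \<nu> times that square.\<close>

lemma Q'_gap_decreasing_step:
  assumes n: "n \<ge> 4" and le: "Q'_gap n \<le> 2"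
  shows "Q'_gap (n + 1) < Q'_gap n"
proof -
  obtain f where f: "(\<Sum>i<n. f i) = 0" "(\<Sum>i<n. (f i)\<^sup>2) > 0"
    and ev: "\<And>y. Q'_form n y f = Q'_gap n * (\<Sum>i<n. y i * f i)"
    using Q'_gap_eigenvector[OF n] by blast
  define \<nu> where "\<nu> = Q'_gap n"
  have \<nu>: "0 < \<nu>" "\<nu> \<le> 2" using Q'_gap_pos[OF n] le by (auto simp: \<nu>_def)
  have "Max ((\<lambda>k. \<bar>f k\<bar>) ` {2..<n}) \<in> (\<lambda>k. \<bar>f k\<bar>) ` {2..<n}"
    using n by (intro Max_in) auto
  then obtain p where p: "2 \<le> p" "p < n" and "\<bar>f p\<bar> = Max ((\<lambda>k. \<bar>f k\<bar>) ` {2..<n})" by auto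
  then have max: "\<bar>f k\<bar> \<le> \<bar>f p\<bar>" if "2 \<le> k" "k < n" for k using that by simp
  have split: "(\<Sum>i<n. f i) = f 0 + f 1 + (\<Sum>i\<in>{2..<n}. f i)"
    using n by (simp add: lessThan_atLeast0 sum.atLeast_Suc_lessThan numeral_2_eq_2)
  \<comment> \<open>The total is 0, so \<open>f 0 + f 1\<close> is balanced by n - 2 values, each at
    most \<open>\<bar>f p\<bar>\<close> in size.\<close>
  have "\<bar>f 0 + f 1\<bar> = \<bar>\<Sum>i\<in>{2..<n}. f i\<bar>" using f(1) split by linarith
  also have "\<dots> \<le> (\<Sum>i\<in>{2..<n}. \<bar>f i\<bar>)" by (rule sum_abs)
  also have "\<dots> \<le> (\<Sum>i\<in>{2..<n}. \<bar>f p\<bar>)" by (intro sum_mono max) auto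
  also have "\<dots> = (real n - 2) * \<bar>f p\<bar>" using n by (simp add: of_nat_diff)
  finally have s: "\<bar>f 0 + f 1\<bar> \<le> (real n - 2) * \<bar>f p\<bar>" .
  have sum_unit: "(\<Sum>i<n. of_bool (i = j) * f i) = f j" if "j < n" for j
    using that by (simp add: of_bool_mult_if)
  have e0: "(real n - 2) * (f 0 - f 1) + 2 * (f 0 - f 2) = \<nu> * f 0"
    using ev[of "\<lambda>i. of_bool (i = 0)"] sum_unit[of 0] n by (simp add: Q'_form_def \<nu>_def)
  have e1: "(real n - 2) * (f 1 - f 0) + (f 1 - f 2) = \<nu> * f 1"
    using ev[of "\<lambda>i. of_bool (i = 1)"] sum_unit[of 1] n by (simp add: Q'_form_def \<nu>_def algebra_simps)
  \<comment> \<open>eliminate \<open>f 2\<close> from the eigenvalue equations at the vertices 0 and 1\<close>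
  have "(6 * real n - 8 - 3 * \<nu>) * (f 0 - f 1) = - \<nu> * (f 0 + f 1)"
  proof -
    have "(6 * real n - 8 - 3 * \<nu>) * (f 0 - f 1) + \<nu> * (f 0 + f 1)
      = 2 * ((real n - 2) * (f 0 - f 1) + 2 * (f 0 - f 2) - \<nu> * f 0)
        - 4 * ((real n - 2) * (f 1 - f 0) + (f 1 - f 2) - \<nu> * f 1)"
      by (simp add: algebra_simps)
    then show ?thesis unfolding e0 e1 by simp
  qed
  then have "\<bar>6 * real n - 8 - 3 * \<nu>\<bar> * \<bar>f 0 - f 1\<bar> = \<nu> * \<bar>f 0 + f 1\<bar>"
    using \<nu>(1) by (metis abs_minus_cancel abs_mult abs_of_pos)
  \<comment> \<open>The margin 3n - 2 - 3\<nu> is positive for n \<ge> 4 and \<nu> \<le> 2.\<close>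
  moreover have "3 * (real n - 2) \<le> \<bar>6 * real n - 8 - 3 * \<nu>\<bar>" using n \<nu> by simp
  ultimately have "3 * (real n - 2) * \<bar>f 0 - f 1\<bar> \<le> \<nu> * \<bar>f 0 + f 1\<bar>"
    by (metis abs_ge_zero mult_right_mono)
  also have "\<dots> \<le> \<nu> * ((real n - 2) * \<bar>f p\<bar>)" using s \<nu> by simp
  finally have "(real n - 2) * (3 * \<bar>f 0 - f 1\<bar>) \<le> (real n - 2) * (\<nu> * \<bar>f p\<bar>)" by (simp only: mult_ac)
  then have d: "3 * \<bar>f 0 - f 1\<bar> \<le> \<nu> * \<bar>f p\<bar>" using n by (subst (asm) mult_le_cancel_left_pos) auto
  \<comment> \<open>Needed for strictness: if \<open>f p\<close> were 0, then \<open>f\<close> would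
    vanish from 2 on, and \<open>d\<close> and \<open>s\<close> would force \<open>f 0\<close> and
    \<open>f 1\<close> to vanish too.\<close>
  have fp: "f p \<noteq> 0"
  proof
    assume "f p = 0"
    then have "f k = 0" if "2 \<le> k" "k < n" for k using max[OF that] by simp
    moreover have "f 0 = 0" "f 1 = 0" using d s \<open>f p = 0\<close> by simp_all
    ultimately have "f k = 0" if "k < n" for k
      using that by (cases "k = 0 \<or> k = 1") auto
    then show False using f(2) by simp
  qed
  have "9 * (f 0 - f 1)\<^sup>2 = (3 * \<bar>f 0 - f 1\<bar>)\<^sup>2" by (simp add: power_mult_distrib)
  also have "\<dots> \<le> (\<nu> * \<bar>f p\<bar>)\<^sup>2" using d by (intro power_mono) auto
  also have "\<dots> = \<nu> * (\<nu> * (f p)\<^sup>2)" by (simp add: power2_eq_square)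
  also have "\<dots> \<le> 2 * (\<nu> * (f p)\<^sup>2)" using \<nu> by (intro mult_right_mono) auto
  finally have d2: "9 * (f 0 - f 1)\<^sup>2 \<le> 2 * (\<nu> * (f p)\<^sup>2)" .
  \<comment> \<open>The mean of the duplicated vector; subtracting it restores sum 0 and leaves the
    energy unchanged.\<close>
  define c where "c = f p / (real n + 1)"
  let ?F = "duplicate p f"
  let ?x = "\<lambda>j. ?F j - c"
  have "(\<Sum>j<n + 1. ?F j) = f p" using sum_duplicate[OF p(2), of "\<lambda>x. x" f] f(1) by simp
  then have x0: "(\<Sum>j<n + 1. ?x j) = 0" unfolding sum_subtractf by (simp add: c_def add.commute)
  have "(\<Sum>j<n + 1. (?x j)\<^sup>2) = (\<Sum>j<n + 1. (?F j)\<^sup>2 - c * ?F j - c * ?x j)"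
    by (intro sum.cong refl) (simp add: power2_eq_square algebra_simps)
  also have "\<dots> = (\<Sum>j<n + 1. (?F j)\<^sup>2) - c * f p"
    using x0 \<open>(\<Sum>j<n + 1. ?F j) = f p\<close>
    by (simp add: sum_subtractf sum_distrib_left[symmetric] del: sum.lessThan_Suc)
  also have "(\<Sum>j<n + 1. (?F j)\<^sup>2) = (\<Sum>j<n. (f j)\<^sup>2) + (f p)\<^sup>2"
    using sum_duplicate[OF p(2), of "\<lambda>x. x\<^sup>2" f] by simp
  finally have nx: "(\<Sum>j<n + 1. (?x j)\<^sup>2) = (\<Sum>j<n. (f j)\<^sup>2) + (1 - 1 / (real n + 1)) * (f p)\<^sup>2"
    by (simp add: c_def power2_eq_square algebra_simps)
  have "Q'_gap (n + 1) * (\<Sum>j<n + 1. (?x j)\<^sup>2) \<le> Q'_form (n + 1) ?x ?x"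
    using n x0 by (intro Q'_gap_le) auto
  also have "\<dots> = Q'_form (n + 1) ?F ?F" by (simp add: Q'_form_def)
  also have "\<dots> = \<nu> * (\<Sum>j<n. (f j)\<^sup>2) + (f 0 - f 1)\<^sup>2"
    unfolding Q'_form_duplicate[OF p] ev by (simp add: \<nu>_def power2_eq_square)
  also have "\<dots> < \<nu> * (\<Sum>j<n + 1. (?x j)\<^sup>2)"
  proof -
    \<comment> \<open>From n \<ge> 4; what matters is that 4/5 beats the 2/9 in
      \<open>d2\<close>.\<close>
    have "(4 / 5) * (f p)\<^sup>2 \<le> (1 - 1 / (real n + 1)) * (f p)\<^sup>2"
      using n by (intro mult_right_mono) (auto simp: field_simps)
    then have "(4 / 5) * (\<nu> * (f p)\<^sup>2) \<le> \<nu> * ((1 - 1 / (real n + 1)) * (f p)\<^sup>2)"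
      using \<nu>(1) by (metis mult.left_commute mult_left_mono less_imp_le)
    moreover have "0 < \<nu> * (f p)\<^sup>2" using \<nu> fp by simp
    ultimately show ?thesis unfolding nx distrib_left using d2 by linarith
  qed
  finally show ?thesis
    unfolding \<nu>_def by (rule mult_right_less_imp_less) (intro sum_nonneg zero_le_power2)
qed

text \<open>The vector (1, 1, 1, -3) varies only along the edge from 2 to 3, giving energy 16
  against squared norm 12.\<close>

lemma Q'_gap_4_le: "Q'_gap 4 \<le> 4 / 3"
proof -
  define x :: "nat \<Rightarrow> real" where "x i = (if i = 3 then -3 else 1)" for i
  have "{..<4} = {0, 1, 2, 3 :: nat}" "{2..<4 - 1} = {2 :: nat}" by auto
  then have "(\<Sum>i<4. x i) = 0" "(\<Sum>i<4. (x i)\<^sup>2) = 12" "Q'_form 4 x x = 16"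
    unfolding Q'_form_def by (simp_all add: x_def)
  then show ?thesis using Q'_gap_le[of 4 x] by (simp del: sum.lessThan_Suc)
qed

text \<open>The step lemma needs the bound 2 and also preserves it, so induction from n = 4 supplies
  its hypothesis for all n.\<close>

lemma Q'_gap_le_2:
  assumes "n \<ge> 4"
  shows "Q'_gap n \<le> 2"
  using assms
proof (induction n rule: dec_induct)
  case base
  then show ?case using Q'_gap_4_le by simp
next
  case (step n)
  then show ?case using Q'_gap_decreasing_step[of n] by simp
qed

section \<open>Comparing the gaps of $\mathsf Q_n$\<close>

text \<open>\<open>h i\<close> occurs with weight i + 1 at j = i + 1 and with weight m - i at j = i,
  in total m + 1. The end values \<open>h (0 - 1)\<close> and \<open>h m\<close> have weight
  0.\<close>

lemma sum_weighted_neighbours: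
  fixes h :: "nat \<Rightarrow> real"
  shows "(\<Sum>j<m + 1. real j * h (j - 1) + (real m - real j) * h j) = (real m + 1) * (\<Sum>i<m. h i)"
proof -
  have "(\<Sum>j<m + 1. real j * h (j - 1)) = (\<Sum>i<m. (real i + 1) * h i)"
    using sum.lessThan_Suc_shift[of "\<lambda>j. real j * h (j - 1)" m] by (simp add: add.commute)
  moreover have "(\<Sum>j<m + 1. (real m - real j) * h j) = (\<Sum>j<m. (real m - real j) * h j)" by simp
  ultimately have "(\<Sum>j<m + 1. real j * h (j - 1) + (real m - real j) * h j)
      = (\<Sum>i<m. (real i + 1) * h i + (real m - real i) * h i)"
    unfolding sum.distrib by linarith
  also have "\<dots> = (\<Sum>i<m. (real m + 1) * h i)" by (intro sum.cong refl) (simp add: algebra_simps)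
  finally show ?thesis by (simp add: sum_distrib_left)
qed

lemma convex_square_2:
  fixes a b x y :: real
  assumes "a \<ge> 0" "b \<ge> 0"
  shows "(a * x + b * y)\<^sup>2 \<le> (a + b) * (a * x\<^sup>2 + b * y\<^sup>2)"
proof -
  have "(a + b) * (a * x\<^sup>2 + b * y\<^sup>2) - (a * x + b * y)\<^sup>2 = a * b * (x - y)\<^sup>2"
    by (simp add: power2_eq_square algebra_simps)
  then show ?thesis using assms by (metis diff_ge_0_iff_ge mult_nonneg_nonneg zero_le_power2)
qed

lemma convex_square_3:
  fixes a b x y z :: real
  assumes "a \<ge> 0" "b \<ge> 0"
  shows "(a * x + b * y + z)\<^sup>2 \<le> (a + b + 1) * (a * x\<^sup>2 + b * y\<^sup>2 + z\<^sup>2)"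
proof -
  have "(a + b + 1) * (a * x\<^sup>2 + b * y\<^sup>2 + z\<^sup>2) - (a * x + b * y + z)\<^sup>2
    = a * b * (x - y)\<^sup>2 + a * (x - z)\<^sup>2 + b * (y - z)\<^sup>2"
    by (simp add: power2_eq_square algebra_simps)
  moreover have "a * b * (x - y)\<^sup>2 + a * (x - z)\<^sup>2 + b * (y - z)\<^sup>2 \<ge> 0" using assms by simp
  ultimately show ?thesis by linarith
qed

text \<open>Interpolation of \<open>r\<close> values to \<open>r + 1\<close> values with weights for which vectors of sum 0 are
  mapped to vectors of sum 0.  The values \<open>f (0 - 1) = f 0\<close> and \<open>f r\<close> occur with coefficient 0.\<close>

definition stretch :: "nat \<Rightarrow> (nat \<Rightarrow> real) \<Rightarrow> nat \<Rightarrow> real" where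
  "stretch r f j = (real j * f (j - 1) + (real r - real j) * f j) / real r"

context
  fixes q r :: nat and f :: "nat \<Rightarrow> real"
  assumes r: "r = q + 2"
begin

lemma stretch_mult: "real r * stretch r f j = real j * f (j - 1) + (real r - real j) * f j"
  using r by (simp add: stretch_def)

lemma sum_stretch: "real r * (\<Sum>j<r + 1. stretch r f j) = (real r + 1) * (\<Sum>i<r. f i)"
  using sum_weighted_neighbours[of f r] by (simp only: sum_distrib_left stretch_mult)

text \<open>The square of a weighted mean is the mean of the squares minus a variance, here
  \<open>w j\<close>. It vanishes at both ends, and j (r - j) is at most a quarter of the square of
  r.\<close>

lemma sum_stretch_square:
  "(real r)\<^sup>2 * (\<Sum>j<r + 1. (stretch r f j)\<^sup>2)
    \<ge> real r * (real r + 1) * (\<Sum>i<r. (f i)\<^sup>2) - (real r)\<^sup>2 / 4 * (\<Sum>k<q + 1. (f k - f (k + 1))\<^sup>2)"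
proof -
  define w where "w j = real j * (real r - real j) * (f (j - 1) - f j)\<^sup>2" for j
  have "(real r)\<^sup>2 * (stretch r f j)\<^sup>2 = real r * (real j * (f (j - 1))\<^sup>2 + (real r - real j) * (f j)\<^sup>2) - w j" for j
    unfolding power_mult_distrib[symmetric] stretch_mult w_def by (simp add: power2_eq_square algebra_simps)
  then have "(real r)\<^sup>2 * (\<Sum>j<r + 1. (stretch r f j)\<^sup>2)
    = real r * (\<Sum>j<r + 1. real j * (f (j - 1))\<^sup>2 + (real r - real j) * (f j)\<^sup>2) - (\<Sum>j<r + 1. w j)"
    by (simp only: sum_distrib_left sum_subtractf)
  also have "\<dots> = real r * (real r + 1) * (\<Sum>i<r. (f i)\<^sup>2) - (\<Sum>j<r + 1. w j)"
    unfolding sum_weighted_neighbours[of "\<lambda>i. (f i)\<^sup>2" r] by simp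
  also have "(\<Sum>j<r + 1. w j) = (\<Sum>k<q + 1. w (k + 1))"
  proof -
    have "(\<Sum>j<r + 1. w j) = w 0 + (\<Sum>k<q + 2. w (k + 1))"
      using sum.lessThan_Suc_shift[of w r] r by simp
    moreover have "w 0 = 0" "w (q + 2) = 0" by (simp_all add: w_def r)
    ultimately show ?thesis by simp
  qed
  finally have 1: "(real r)\<^sup>2 * (\<Sum>j<r + 1. (stretch r f j)\<^sup>2)
    = real r * (real r + 1) * (\<Sum>i<r. (f i)\<^sup>2) - (\<Sum>k<q + 1. w (k + 1))" .
  have "(\<Sum>k<q + 1. w (k + 1)) \<le> (\<Sum>k<q + 1. (real r)\<^sup>2 / 4 * (f k - f (k + 1))\<^sup>2)"
  proof (intro sum_mono)
    fix k
    have "4 * (real (k + 1) * (real r - real (k + 1))) \<le> (real r)\<^sup>2"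
      using zero_le_power2[of "real r - 2 * real (k + 1)"] by (simp add: power2_eq_square algebra_simps)
    then have "real (k + 1) * (real r - real (k + 1)) * (f k - f (k + 1))\<^sup>2 \<le> (real r)\<^sup>2 / 4 * (f k - f (k + 1))\<^sup>2"
      by (intro mult_right_mono) auto
    then show "w (k + 1) \<le> (real r)\<^sup>2 / 4 * (f k - f (k + 1))\<^sup>2" unfolding w_def by simp
  qed
  then show ?thesis unfolding 1 sum_distrib_left[of "(real r)\<^sup>2 / 4"] by linarith
qed

text \<open>r times a difference of \<open>stretch r f\<close> combines two adjacent differences of
  \<open>f\<close> with weights j and r - 1 - j. Convexity contributes r - 1,
  \<open>sum_weighted_neighbours\<close> contributes r, and one r cancels.\<close>

lemma sum_stretch_diff_1:
  "real r * (\<Sum>j<q + 2. (stretch r f j - stretch r f (j + 1))\<^sup>2)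
    \<le> (real r - 1) * (\<Sum>k<q + 1. (f k - f (k + 1))\<^sup>2)"
proof -
  define g where "g k = f k - f (k + 1)" for k
  let ?m = "q + 1"
  have "(real r)\<^sup>2 * (stretch r f j - stretch r f (j + 1))\<^sup>2
     \<le> real ?m * (real j * (g (j - 1))\<^sup>2 + (real ?m - real j) * (g j)\<^sup>2)" if "j < ?m + 1" for j
  proof -
    have "real r * (stretch r f j - stretch r f (j + 1)) = real j * g (j - 1) + (real ?m - real j) * g j"
      unfolding right_diff_distrib stretch_mult g_def by (cases j) (simp_all add: r algebra_simps)
    moreover have "(real j * g (j - 1) + (real ?m - real j) * g j)\<^sup>2
       \<le> real ?m * (real j * (g (j - 1))\<^sup>2 + (real ?m - real j) * (g j)\<^sup>2)"
      using convex_square_2[of "real j" "real ?m - real j" "g (j - 1)" "g j"] that by simp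
    ultimately show ?thesis unfolding power_mult_distrib[symmetric] by simp
  qed
  then have "(\<Sum>j<?m + 1. (real r)\<^sup>2 * (stretch r f j - stretch r f (j + 1))\<^sup>2)
     \<le> (\<Sum>j<?m + 1. real ?m * (real j * (g (j - 1))\<^sup>2 + (real ?m - real j) * (g j)\<^sup>2))"
    by (intro sum_mono) simp
  also have "\<dots> = real ?m * ((real ?m + 1) * (\<Sum>i<?m. (g i)\<^sup>2))"
    unfolding sum_distrib_left[symmetric] sum_weighted_neighbours[of "\<lambda>i. (g i)\<^sup>2" ?m] ..
  finally have "real r * (real r * (\<Sum>j<q + 2. (stretch r f j - stretch r f (j + 1))\<^sup>2))
    \<le> real r * ((real r - 1) * (\<Sum>i<q + 1. (g i)\<^sup>2))"
    unfolding sum_distrib_left[symmetric] by (simp add: r power2_eq_square algebra_simps del: sum.lessThan_Suc)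
  then show ?thesis unfolding g_def using r by (subst (asm) mult_le_cancel_left_pos) auto
qed

text \<open>As for neighbours, with weights j and r - 2 - j. The shift of the weights over two steps
  leaves the extra term \<open>2 * g j\<close>, which enters \<open>convex_square_3\<close> with
  weight 1.\<close>

lemma sum_stretch_diff_2:
  "(real r)\<^sup>2 * (\<Sum>j<q + 1. (stretch r f j - stretch r f (j + 2))\<^sup>2)
    \<le> (real r - 1) * ((real r - 1) * (\<Sum>k<q. (f k - f (k + 2))\<^sup>2) + 4 * (\<Sum>k<q + 1. (f k - f (k + 1))\<^sup>2))"
proof -
  define g where "g k = f k - f (k + 1)" for k
  define s where "s k = f k - f (k + 2)" for k
  have "(real r)\<^sup>2 * (stretch r f j - stretch r f (j + 2))\<^sup>2
     \<le> (real q + 1) * (real j * (s (j - 1))\<^sup>2 + (real q - real j) * (s j)\<^sup>2 + 4 * (g j)\<^sup>2)" if "j < q + 1" for j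
  proof -
    have "real r * (stretch r f j - stretch r f (j + 2)) = real j * s (j - 1) + (real q - real j) * s j + 2 * g j"
      unfolding right_diff_distrib stretch_mult g_def s_def by (cases j) (simp_all add: r algebra_simps)
    moreover have "(real j * s (j - 1) + (real q - real j) * s j + 2 * g j)\<^sup>2
       \<le> (real q + 1) * (real j * (s (j - 1))\<^sup>2 + (real q - real j) * (s j)\<^sup>2 + 4 * (g j)\<^sup>2)"
      using convex_square_3[of "real j" "real q - real j" "s (j - 1)" "s j" "2 * g j"] that by simp
    ultimately show ?thesis unfolding power_mult_distrib[symmetric] by simp
  qed
  then have "(\<Sum>j<q + 1. (real r)\<^sup>2 * (stretch r f j - stretch r f (j + 2))\<^sup>2)
     \<le> (\<Sum>j<q + 1. (real q + 1) * (real j * (s (j - 1))\<^sup>2 + (real q - real j) * (s j)\<^sup>2 + 4 * (g j)\<^sup>2))"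
    by (intro sum_mono) simp
  also have "\<dots> = (real q + 1) * ((real q + 1) * (\<Sum>i<q. (s i)\<^sup>2) + 4 * (\<Sum>i<q + 1. (g i)\<^sup>2))"
    unfolding sum_distrib_left[symmetric] sum.distrib[of "\<lambda>j. real j * (s (j - 1))\<^sup>2 + (real q - real j) * (s j)\<^sup>2"]
      sum_weighted_neighbours[of "\<lambda>i. (s i)\<^sup>2" q] ..
  finally show ?thesis unfolding sum_distrib_left[symmetric] s_def g_def by (simp add: r add.commute del: sum.lessThan_Suc)
qed

end

section \<open>Differences at distance two in an eigenvector\<close>

lemma sum_by_parts:
  fixes h f :: "nat \<Rightarrow> real"
  shows "(\<Sum>k<m + 1. (h (k + 1) - h k) * f k) = (\<Sum>k<m. h (k + 1) * (f k - f (k + 1))) + h (m + 1) * f m - h 0 * f 0"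
  by (induction m) (simp_all add: algebra_simps)

text \<open>Each doubled summand is the sum of two squared adjacent differences and of squares of
  \<open>a\<close> that telescope. Inner squares are dropped, and the boundary is bounded using
  \<open>(2 * x - y)\<^sup>2 \<ge> 0\<close>.\<close>

lemma second_difference_lower:
  fixes a :: "nat \<Rightarrow> real"
  shows "(\<Sum>k<m + 1. a (k + 1) * (2 * a (k + 1) - a k - a (k + 2))) \<ge> - ((a 0)\<^sup>2 + (a (m + 2))\<^sup>2) / 4"
proof -
  \<comment> \<open>Both boundary expressions stay in the claim because the induction step replaces
    the right one.\<close>
  have "2 * (\<Sum>k<m + 1. a (k + 1) * (2 * a (k + 1) - a k - a (k + 2)))
     \<ge> ((a 1 - a 0)\<^sup>2 + (a 1)\<^sup>2 - (a 0)\<^sup>2) + ((a (m + 1) - a (m + 2))\<^sup>2 + (a (m + 1))\<^sup>2 - (a (m + 2))\<^sup>2)"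
  proof (induction m)
    case 0
    then show ?case by (simp add: power2_eq_square algebra_simps)
  next
    case (Suc m)
    have eqs: "Suc m + 1 = m + 2" "Suc m + 2 = m + 3" "m + 2 = Suc (m + 1)" "m + 1 + 1 = m + 2" "m + 1 + 2 = m + 3"
      by simp_all
    have "2 * (a (m + 2) * (2 * a (m + 2) - a (m + 1) - a (m + 3)))
      = ((a (m + 2) - a (m + 3))\<^sup>2 + (a (m + 2))\<^sup>2 - (a (m + 3))\<^sup>2)
        - ((a (m + 1) - a (m + 2))\<^sup>2 + (a (m + 1))\<^sup>2 - (a (m + 2))\<^sup>2) + 2 * (a (m + 2) - a (m + 1))\<^sup>2"
      by (simp add: power2_eq_square algebra_simps)
    moreover have "(a (m + 2) - a (m + 1))\<^sup>2 \<ge> 0" by simp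
    moreover have "(\<Sum>k<Suc m + 1. a (k + 1) * (2 * a (k + 1) - a k - a (k + 2)))
      = (\<Sum>k<m + 1. a (k + 1) * (2 * a (k + 1) - a k - a (k + 2)))
        + a (m + 2) * (2 * a (m + 2) - a (m + 1) - a (m + 3))"
      unfolding eqs(1) eqs(3) sum.lessThan_Suc eqs(4,5) unfolding eqs(3) ..
    ultimately show ?case using Suc unfolding eqs(1,2) by linarith
  qed
  moreover have "(x - y)\<^sup>2 + x\<^sup>2 - y\<^sup>2 \<ge> - (y\<^sup>2) / 2" for x y :: real
    using zero_le_power2[of "2 * x - y"] by (simp add: power2_eq_square algebra_simps)
  from this[of "a 0" "a 1"] this[of "a (m + 2)" "a (m + 1)"]
  have "((a 1 - a 0)\<^sup>2 + (a 1)\<^sup>2 - (a 0)\<^sup>2) + ((a (m + 1) - a (m + 2))\<^sup>2 + (a (m + 1))\<^sup>2 - (a (m + 2))\<^sup>2)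
     \<ge> - ((a 0)\<^sup>2 + (a (m + 2))\<^sup>2) / 2" by argo
  ultimately show ?thesis by linarith
qed

text \<open>The eigenvalue equation of \<open>f\<close> is tested against \<open>y = T f\<close>, where \<open>T\<close> is the Laplacian of the
  unweighted path and \<open>Y = \<bar>T f\<bar>\<^sup>2\<close>. A small \<open>Y\<close> excludes that consecutive differences of \<open>f\<close> alternate
  in sign, which is the only way for \<open>D\<close> to be small compared with \<open>P\<close>.\<close>

lemma Q_form_eigenvector_diff_2:
  fixes f :: "nat \<Rightarrow> real"
  assumes ev: "\<And>y. Q_form (q + 3) y f = \<mu> * (\<Sum>i<q + 3. y i * f i)"
  defines "P \<equiv> \<Sum>k<q + 2. (f k - f (k + 1))\<^sup>2" and "D \<equiv> \<Sum>k<q + 1. (f k - f (k + 2))\<^sup>2"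
  obtains Y where "D \<ge> 4 * P - 2 * Y" "(real q + 1 / 2) * Y \<le> \<mu> * P" "Y \<ge> 0"
proof -
  \<comment> \<open>Differences along the path, extended by 0 beyond both ends, so that
    \<open>y\<close> is the path Laplacian of \<open>f\<close> at the end vertices too.\<close>
  define h where "h k = (if k = 0 \<or> k > q + 2 then 0 else f (k - 1) - f k)" for k
  define y where "y k = h (k + 1) - h k" for k
  \<comment> \<open>Inside, these are the differences at distance two; \<open>a 0\<close> and
    \<open>a (q + 2)\<close> are \<open>y\<close> at the ends up to sign, which \<open>ends\<close>
    exploits.\<close>
  define a where "a k = h k + h (k + 1)" for k
  define Y where "Y = (\<Sum>k<q + 3. (y k)\<^sup>2)"
  have h1: "h (k + 1) = f k - f (k + 1)" if "k < q + 2" for k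
    using that by (simp add: h_def)
  have h0: "h 0 = 0" "h (q + 3) = 0" by (auto simp: h_def)
  have P: "P = (\<Sum>k<q + 2. (h (k + 1))\<^sup>2)" unfolding P_def by (intro sum.cong refl) (simp only: h1 lessThan_iff)
  have s: "f k - f (k + 2) = a (k + 1)" if "k < q + 1" for k
    using that h1[of k] h1[of "k + 1"] by (simp add: a_def)
  have D: "D = (\<Sum>k<q + 1. (a (k + 1))\<^sup>2)" unfolding D_def by (intro sum.cong refl) (simp only: s lessThan_iff)
  have fy: "(\<Sum>i<q + 3. y i * f i) = P"
  proof -
    have "(\<Sum>i<q + 3. y i * f i) = (\<Sum>k<q + 2. h (k + 1) * (f k - f (k + 1)))"
      using sum_by_parts[of h f "q + 2"] h0 by (simp add: y_def numeral_3_eq_3 del: sum.lessThan_Suc)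
    also have "\<dots> = P" unfolding P_def by (intro sum.cong refl) (simp only: h1 lessThan_iff power2_eq_square)
    finally show ?thesis .
  qed
  have y1: "(\<Sum>k<q + 2. (y k - y (k + 1)) * (f k - f (k + 1))) = Y"
  proof -
    have "(\<Sum>k<q + 2. (y k - y (k + 1)) * (f k - f (k + 1))) = (\<Sum>k<q + 2. h (k + 1) * (y k - y (k + 1)))"
      by (intro sum.cong refl) (simp only: h1 lessThan_iff mult.commute)
    also have "\<dots> = (\<Sum>k<q + 3. (h (k + 1) - h k) * y k)"
      using sum_by_parts[of h y "q + 2"] h0 by (simp add: numeral_3_eq_3 del: sum.lessThan_Suc)
    finally show ?thesis unfolding Y_def by (simp only: y_def power2_eq_square)
  qed
  have y2: "(\<Sum>k<q + 1. (y k - y (k + 2)) * (f k - f (k + 2))) \<ge> - ((a 0)\<^sup>2 + (a (q + 2))\<^sup>2) / 4"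
  proof -
    have "(\<Sum>k<q + 1. (y k - y (k + 2)) * (f k - f (k + 2)))
      = (\<Sum>k<q + 1. a (k + 1) * (2 * a (k + 1) - a k - a (k + 2)))"
    proof (intro sum.cong refl)
      fix k assume "k \<in> {..<q + 1}"
      then have 1: "f k - f (k + 2) = a (k + 1)" by (intro s) simp
      have 2: "y k - y (k + 2) = 2 * a (k + 1) - a k - a (k + 2)" by (simp add: y_def a_def)
      show "(y k - y (k + 2)) * (f k - f (k + 2)) = a (k + 1) * (2 * a (k + 1) - a k - a (k + 2))"
        unfolding 1 2 by (rule mult.commute)
    qed
    then show ?thesis using second_difference_lower[of a q] by simp
  qed
  have ends: "Y = (a 0)\<^sup>2 + (\<Sum>k<q + 1. (y (k + 1))\<^sup>2) + (a (q + 2))\<^sup>2"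
    unfolding Y_def using sum.lessThan_Suc_shift[of "\<lambda>k. (y k)\<^sup>2" "q + 2"] h0
    by (simp add: numeral_3_eq_3 y_def a_def)
  have "(\<Sum>k<q + 1. (y (k + 1))\<^sup>2) \<ge> 0" by (intro sum_nonneg) auto
  with ends have e: "(a 0)\<^sup>2 + (a (q + 2))\<^sup>2 \<le> Y" by linarith
  have "(real q + 1) * Y + 2 * (\<Sum>k<q + 1. (y k - y (k + 2)) * (f k - f (k + 2))) = \<mu> * P"
  proof -
    have "q + 3 - 1 = q + 2" "q + 3 - 2 = q + 1" "real (q + 3) - 2 = real q + 1" by simp_all
    then show ?thesis using ev[of y] unfolding fy Q_form_def by (simp only: y1)
  qed
  then have 1: "(real q + 1 / 2) * Y \<le> \<mu> * P" using y2 e by (simp add: distrib_right)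
  \<comment> \<open>The parallelogram law for consecutive values of \<open>h\<close>.\<close>
  have "(\<Sum>k<q + 3. (a k)\<^sup>2) + Y = (\<Sum>k<q + 3. 2 * (h (k + 1))\<^sup>2 + 2 * (h k)\<^sup>2)"
    unfolding Y_def sum.distrib[symmetric] a_def y_def
    by (intro sum.cong refl) (simp add: power2_eq_square algebra_simps)
  also have "\<dots> = 2 * (\<Sum>k<q + 3. (h (k + 1))\<^sup>2) + 2 * (\<Sum>k<q + 3. (h k)\<^sup>2)"
    by (simp only: sum.distrib sum_distrib_left)
  also have "(\<Sum>k<q + 3. (h (k + 1))\<^sup>2) = P" unfolding P using h0 by (simp add: numeral_3_eq_3)
  also have "(\<Sum>k<q + 3. (h k)\<^sup>2) = P"
    unfolding P using sum.lessThan_Suc_shift[of "\<lambda>k. (h k)\<^sup>2" "q + 2"] h0 by (simp add: numeral_3_eq_3)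
  finally have "(\<Sum>k<q + 3. (a k)\<^sup>2) + Y = 4 * P" by simp
  moreover have "(\<Sum>k<q + 3. (a k)\<^sup>2) = (a 0)\<^sup>2 + D + (a (q + 2))\<^sup>2"
    unfolding D using sum.lessThan_Suc_shift[of "\<lambda>k. (a k)\<^sup>2" "q + 2"] by (simp add: numeral_3_eq_3)
  ultimately have 2: "D \<ge> 4 * P - 2 * Y" using e by linarith
  have "Y \<ge> 0" unfolding Y_def by (intro sum_nonneg) auto
  then show ?thesis using that 1 2 by blast
qed

section \<open>Monotonicity from n = 6 on\<close>

lemma Q_gap_decreasing_step:
  assumes n: "n \<ge> 6" and le: "Q_gap n \<le> 3"
  shows "Q_gap (n + 1) < Q_gap n"
proof -
  obtain f where f: "(\<Sum>i<n. f i) = 0" "(\<Sum>i<n. (f i)\<^sup>2) > 0"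
    and ev: "\<And>y. Q_form n y f = Q_gap n * (\<Sum>i<n. y i * f i)"
    using Q_gap_eigenvector[of n] n by auto
  define q where "q = n - 2"
  have q: "n = q + 2" "q \<ge> 4" using n by (auto simp: q_def)
  have q': "n = (q - 1) + 3" using q by simp
  define P where "P = (\<Sum>k<q + 1. (f k - f (k + 1))\<^sup>2)"
  define D where "D = (\<Sum>k<q. (f k - f (k + 2))\<^sup>2)"
  define N where "N = (\<Sum>i<n. (f i)\<^sup>2)"
  define \<mu> where "\<mu> = Q_gap n"
  define F where "F = stretch n f"
  define T where "T = (\<Sum>j<n + 1. (F j)\<^sup>2)"
  define G where "G = (\<Sum>j<q + 2. (F j - F (j + 1))\<^sup>2)"
  define S where "S = (\<Sum>j<q + 1. (F j - F (j + 2))\<^sup>2)"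
  have \<mu>N: "\<mu> * N = real q * P + 2 * D"
    using ev[of f] by (simp add: Q_form_def q N_def P_def D_def \<mu>_def power2_eq_square[symmetric] del: sum.lessThan_Suc)
  have P0: "P \<ge> 0" and D0: "D \<ge> 0" unfolding P_def D_def by (intro sum_nonneg zero_le_power2)+
  have "0 < P"
  proof (rule ccontr)
    assume "\<not> 0 < P"
    then have "P = 0" using P0 by simp
    then have "f k = f (k + 1)" if "k < q + 1" for k
      using that unfolding P_def by (subst (asm) sum_nonneg_eq_0_iff) auto
    then have "f i = 0" if "i < n" for i
      using zero_if_constant_and_sum_zero[of "q + 1" f i] f(1) that by (simp add: q)
    then show False using f(2) by simp
  qed
  have \<mu>: "\<mu> \<le> 3" using le by (simp add: \<mu>_def)
  obtain Y where Y: "D \<ge> 4 * P - 2 * Y" "(real (q - 1) + 1 / 2) * Y \<le> \<mu> * P" "Y \<ge> 0"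
  proof (rule Q_form_eigenvector_diff_2[of "q - 1" f \<mu>])
    show "Q_form (q - 1 + 3) y f = \<mu> * (\<Sum>i<q - 1 + 3. y i * f i)" for y
      using ev[of y] unfolding \<mu>_def q' .
  qed (use q(2) in \<open>simp add: P_def D_def\<close>)
  \<comment> \<open>With q - 1 \<ge> 3 and \<mu> \<le> 3, \<open>Y\<close> is at most 6/7
    \<open>P\<close>, and 4 - 12/7 = 16/7.\<close>
  have "7 / 2 * Y \<le> (real (q - 1) + 1 / 2) * Y" using q Y(3) by (intro mult_right_mono) auto
  also have "\<dots> \<le> 3 * P" using Y(2) mult_right_mono[OF \<mu> P0] by linarith
  finally have DP: "7 * D \<ge> 16 * P" using Y(1) by linarith
  have TN: "(real n)\<^sup>2 * T \<ge> real n * (real n + 1) * N - (real n)\<^sup>2 / 4 * P"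
    using sum_stretch_square[OF q(1), of f] by (simp only: T_def F_def N_def P_def)
  have GP: "real n * G \<le> (real n - 1) * P"
    using sum_stretch_diff_1[OF q(1), of f] by (simp only: G_def F_def P_def)
  have SD: "(real n)\<^sup>2 * S \<le> (real n - 1) * ((real n - 1) * D + 4 * P)"
    using sum_stretch_diff_2[OF q(1), of f] by (simp only: S_def F_def P_def D_def)
  have sF: "(\<Sum>j<n + 1. F j) = 0"
    using sum_stretch[OF q(1), of f] f(1) q by (simp add: F_def del: sum.lessThan_Suc)
  have \<mu>0: "\<mu> \<ge> 0"
  proof -
    have "0 \<le> \<mu> * N" unfolding \<mu>N using P0 D0 by simp
    then show ?thesis using f(2) unfolding N_def by (simp add: zero_le_mult_iff)
  qed
  have "(real n)\<^sup>2 * ((real n - 1) * G + 2 * S) < (real n)\<^sup>2 * (\<mu> * T)"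
  proof -
    have "(real n)\<^sup>2 * ((real n - 1) * G) = real n * (real n - 1) * (real n * G)"
      by (simp add: power2_eq_square)
    also have "\<dots> \<le> real n * (real n - 1) * ((real n - 1) * P)"
      using GP n by (intro mult_left_mono) auto
    finally have 1: "(real n)\<^sup>2 * ((real n - 1) * G) \<le> real n * (real n - 1) * ((real n - 1) * P)" .
    have "\<mu> * (real n * (real n + 1) * N - (real n)\<^sup>2 / 4 * P) \<le> \<mu> * ((real n)\<^sup>2 * T)"
      using TN \<mu>0 by (rule mult_left_mono)
    moreover have "\<mu> * (real n * (real n + 1) * N - (real n)\<^sup>2 / 4 * P)
        = real n * (real n + 1) * (\<mu> * N) - \<mu> * ((real n)\<^sup>2 / 4 * P)" by (simp add: algebra_simps)
    moreover have "\<mu> * N = (real n - 2) * P + 2 * D" unfolding \<mu>N by (simp add: q(1))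
    moreover have "\<mu> * ((real n)\<^sup>2 / 4 * P) \<le> 3 * ((real n)\<^sup>2 / 4 * P)"
      using \<mu> P0 by (intro mult_right_mono) auto
    moreover have "3 * ((real n)\<^sup>2 / 4 * P) = 3 / 4 * ((real n)\<^sup>2 * P)" by simp
    moreover have "\<mu> * ((real n)\<^sup>2 * T) = (real n)\<^sup>2 * (\<mu> * T)" by simp
    ultimately have 2: "real n * (real n + 1) * ((real n - 2) * P + 2 * D) - 3 / 4 * ((real n)\<^sup>2 * P) \<le> (real n)\<^sup>2 * (\<mu> * T)"
      by (smt (verit))
    \<comment> \<open>The cubic terms in n cancel. The coefficient of \<open>P\<close> that remains
      is negative for moderate n, so the term with \<open>D\<close> has to compensate.\<close>
    have 3: "real n * (real n + 1) * ((real n - 2) * P + 2 * D) - 3 / 4 * ((real n)\<^sup>2 * P)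
        - real n * (real n - 1) * ((real n - 1) * P) - 2 * ((real n - 1) * ((real n - 1) * D + 4 * P))
      = (1 / 4 * (real n)\<^sup>2 - 11 * real n + 8) * P + 2 * (3 * real n - 1) * D"
      by (simp add: power2_eq_square field_simps)
    have "2 * (3 * real n - 1) * (16 / 7 * P) \<le> 2 * (3 * real n - 1) * D"
      using DP n by (intro mult_left_mono) auto
    moreover have "0 < (1 / 4 * (real n)\<^sup>2 - 11 * real n + 8) * P + 2 * (3 * real n - 1) * (16 / 7 * P)"
    proof -
      \<comment> \<open>Here 96/7 is 6 times 16/7; it exceeds 11, which is why the ratio 16/7
        suffices.\<close>
      have "0 < 1 / 4 * (real n)\<^sup>2 + (96 / 7 - 11) * real n + (8 - 32 / 7)"
        by (intro add_nonneg_pos add_nonneg_nonneg) auto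
      moreover have "(1 / 4 * (real n)\<^sup>2 - 11 * real n + 8) * P + 2 * (3 * real n - 1) * (16 / 7 * P)
        = (1 / 4 * (real n)\<^sup>2 + (96 / 7 - 11) * real n + (8 - 32 / 7)) * P"
        by (simp add: field_simps)
      ultimately show ?thesis using \<open>0 < P\<close> by (simp only: mult_pos_pos)
    qed
    ultimately show ?thesis using 1 2 3 SD by (simp only: distrib_left mult.left_commute[of _ 2])
  qed
  then have "(real n - 1) * G + 2 * S < \<mu> * T" using n by simp
  moreover have "Q_form (n + 1) F F = (real n - 1) * G + 2 * S"
    by (simp add: Q_form_def G_def S_def q power2_eq_square del: sum.lessThan_Suc)
  moreover have "Q_gap (n + 1) * T \<le> Q_form (n + 1) F F"
    unfolding T_def using n sF by (intro Q_gap_le) auto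
  ultimately have "Q_gap (n + 1) * T < \<mu> * T" by linarith
  then show ?thesis
    unfolding \<mu>_def T_def by (rule mult_right_less_imp_less) (intro sum_nonneg zero_le_power2)
qed

section \<open>Explicit gap bounds for n = 4, 5, 6\<close>

text \<open>For vectors of sum 0 the energy minus 4 times the squared norm is a sum of squares. It
  vanishes at (1, 0, 0, -1), so the bound is sharp.\<close>

lemma Q_gap_4_ge: "Q_gap 4 \<ge> 4"
proof -
  obtain f where f: "(\<Sum>i<4. f i) = 0" "(\<Sum>i<4. (f i)\<^sup>2) > 0"
    and ev: "\<And>y. Q_form 4 y f = Q_gap 4 * (\<Sum>i<4. y i * f i)"
    using Q_gap_eigenvector[of 4] by auto
  have s: "{..<4} = {0, 1, 2, 3 :: nat}" "{..<4 - 1} = {0, 1, 2 :: nat}" "{..<4 - 2} = {0, 1 :: nat}" by auto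
  have E: "Q_form 4 f f = 2 * ((f 0 - f 1)\<^sup>2 + (f 1 - f 2)\<^sup>2 + (f 2 - f 3)\<^sup>2) + 2 * ((f 0 - f 2)\<^sup>2 + (f 1 - f 3)\<^sup>2)"
    unfolding Q_form_def s by (simp add: power2_eq_square eval_nat_numeral)
  have N: "(\<Sum>i<4. (f i)\<^sup>2) = (f 0)\<^sup>2 + (f 1)\<^sup>2 + (f 2)\<^sup>2 + (f 3)\<^sup>2" unfolding s by simp
  have f3: "f 3 = - (f 0 + f 1 + f 2)" using f(1) unfolding s by simp
  have "Q_form 4 f f - 4 * (\<Sum>i<4. (f i)\<^sup>2) = 4 * (f 1)\<^sup>2 + 4 * (f 2)\<^sup>2 + 2 * (f 0 + f 3)\<^sup>2"
    unfolding E N f3 by (simp add: power2_eq_square algebra_simps)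
  moreover have "4 * (f 1)\<^sup>2 + 4 * (f 2)\<^sup>2 + 2 * (f 0 + f 3)\<^sup>2 \<ge> 0" by simp
  moreover have "Q_form 4 f f = Q_gap 4 * (\<Sum>i<4. (f i)\<^sup>2)" using ev[of f] by (simp add: power2_eq_square)
  ultimately have "4 * (\<Sum>i<4. (f i)\<^sup>2) \<le> Q_gap 4 * (\<Sum>i<4. (f i)\<^sup>2)" by linarith
  then show ?thesis using f(2) by (rule mult_right_le_imp_le)
qed

lemma Q_gap_5_ge: "Q_gap 5 \<ge> 3"
proof -
  obtain f where f: "(\<Sum>i<5. f i) = 0" "(\<Sum>i<5. (f i)\<^sup>2) > 0"
    and ev: "\<And>y. Q_form 5 y f = Q_gap 5 * (\<Sum>i<5. y i * f i)"
    using Q_gap_eigenvector[of 5] by auto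
  have s: "{..<5} = {0, 1, 2, 3, 4 :: nat}" "{..<5 - 1} = {0, 1, 2, 3 :: nat}" "{..<5 - 2} = {0, 1, 2 :: nat}" by auto
  \<comment> \<open>Completed squares of the odd and the even part of \<open>f\<close> under the
    reflection of the path.\<close>
  define R where "R = (f 0 - f 4 - 3 / 2 * (f 1 - f 3))\<^sup>2 + 5 / 4 * (f 1 - f 3)\<^sup>2
      + 12 * (f 0 + f 4 + 7 / 8 * (f 1 + f 3))\<^sup>2 + 85 / 16 * (f 1 + f 3)\<^sup>2"
  have E: "Q_form 5 f f = 3 * ((f 0 - f 1)\<^sup>2 + (f 1 - f 2)\<^sup>2 + (f 2 - f 3)\<^sup>2 + (f 3 - f 4)\<^sup>2)
      + 2 * ((f 0 - f 2)\<^sup>2 + (f 1 - f 3)\<^sup>2 + (f 2 - f 4)\<^sup>2)"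
    unfolding Q_form_def s by (simp add: power2_eq_square eval_nat_numeral)
  have N: "(\<Sum>i<5. (f i)\<^sup>2) = (f 0)\<^sup>2 + (f 1)\<^sup>2 + (f 2)\<^sup>2 + (f 3)\<^sup>2 + (f 4)\<^sup>2" unfolding s by simp
  have f2: "f 2 = - (f 0 + f 1 + f 3 + f 4)" using f(1) unfolding s by simp
  have "Q_form 5 f f - 3 * (\<Sum>i<5. (f i)\<^sup>2) = R"
    unfolding E N R_def f2 by (simp add: power2_eq_square field_simps)
  moreover have "R \<ge> 0" by (simp add: R_def)
  moreover have "Q_form 5 f f = Q_gap 5 * (\<Sum>i<5. (f i)\<^sup>2)" using ev[of f] by (simp add: power2_eq_square)
  ultimately have "3 * (\<Sum>i<5. (f i)\<^sup>2) \<le> Q_gap 5 * (\<Sum>i<5. (f i)\<^sup>2)" by linarith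
  then show ?thesis using f(2) by (rule mult_right_le_imp_le)
qed

text \<open>A linear test vector: neighbours differ by 1 and vertices at distance two by 2.\<close>

lemma Q_gap_5_le: "Q_gap 5 \<le> 18 / 5"
proof -
  define x :: "nat \<Rightarrow> real" where "x i = 2 - real i" for i
  have s: "{..<5} = {0, 1, 2, 3, 4 :: nat}" "{..<5 - 1} = {0, 1, 2, 3 :: nat}" "{..<5 - 2} = {0, 1, 2 :: nat}" by auto
  have "(\<Sum>i<5. x i) = 0" "(\<Sum>i<5. (x i)\<^sup>2) = 10" "Q_form 5 x x = 36"
    unfolding Q_form_def s by (simp_all add: x_def)
  then show ?thesis using Q_gap_le[of 5 x] by simp
qed

lemma Q_gap_6_le: "Q_gap 6 \<le> 104 / 35"
proof -
  define x :: "nat \<Rightarrow> real" where "x i = 5 - 2 * real i" for i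
  have s: "{..<6} = {0, 1, 2, 3, 4, 5 :: nat}" "{..<6 - 1} = {0, 1, 2, 3, 4 :: nat}" "{..<6 - 2} = {0, 1, 2, 3 :: nat}" by auto
  have "(\<Sum>i<6. x i) = 0" "(\<Sum>i<6. (x i)\<^sup>2) = 70" "Q_form 6 x x = 208"
    unfolding Q_form_def s by (simp_all add: x_def)
  then show ?thesis using Q_gap_le[of 6 x] by simp
qed

lemma Q_gap_le_3:
  assumes "n \<ge> 6"
  shows "Q_gap n \<le> 3"
  using assms
proof (induction n rule: dec_induct)
  case base
  then show ?case using Q_gap_6_le by simp
next
  case (step n)
  then show ?case using Q_gap_decreasing_step[of n] by simp
qed

text \<open>The small cases rest on 18/5 < 4 and 104/35 < 3.\<close>

lemma Q_gap_decreasing: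
  assumes "n \<ge> 4"
  shows "Q_gap (n + 1) < Q_gap n"
proof -
  consider "n = 4" | "n = 5" | "n \<ge> 6" using assms by linarith
  then show ?thesis
  proof cases
    case 3
    then show ?thesis by (intro Q_gap_decreasing_step Q_gap_le_3)
  qed (use Q_gap_4_ge Q_gap_5_ge Q_gap_5_le Q_gap_6_le in auto)
qed

section \<open>From gaps back to eigenvalues\<close>

theorem theorem2p4:
  fixes n :: nat
  assumes "n \<ge> 5"
  shows "eigval_desc 2 (Q'_mat n) > eigval_desc 2 (Q'_mat (n - 1)) + 1
    \<and> eigval_desc 2 (Q_mat n) > eigval_desc 2 (Q_mat (n - 1)) + eigval_desc 2 (Q'_mat n)"
proof -
  obtain m where m: "n = m + 1" "m \<ge> 4" using assms by (cases n) auto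
  have "Q'_gap (m + 1) < Q'_gap m" using m(2) by (intro Q'_gap_decreasing_step Q'_gap_le_2)
  moreover have "Q'_gap (m + 1) > 0" using m(2) by (intro Q'_gap_pos) simp
  moreover have "Q_gap (m + 1) < Q_gap m" using m(2) by (rule Q_gap_decreasing)
  \<comment> \<open>From m to m + 1 the row sum of \<open>Q'_mat\<close> grows by 1, and that of
    \<open>Q_mat\<close> by m + 1, which is the row sum of \<open>Q'_mat (m + 1)\<close>. Both
    claims thus become inequalities between gaps.\<close>
  ultimately show ?thesis
    unfolding m(1) Q_gap_def Q'_gap_def by (simp add: power2_eq_square field_simps)
qed

end
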